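(* Let $F$ be $\mathbb{R}$ or $\mathbb{C}$, $G_n=GL(n,F)$, $1\le d\le n$, and let $\pi\in\mathcal{M}^d_{HC}(G_n)$. Then $\mathfrak{v}_{n-d+1}$ acts nilpotently on $E^d_{HC}(\pi)$. Namely, there exists a number $k$ such that for any $X\in\mathfrak{v}_{n-d+1}$, $X^k$ acts by zero on $E^d_{HC}(\pi)$.
   Context: $G_n$ is embedded in $G_m$, $m>n$, by $g\mapsto\mathrm{diag}(g,\mathrm{Id}_{m-n})$. Gothic letters denote complexified Lie algebras of real Lie groups. $P_n\subset G_n$ is the subgroup of matrices with last row $(0,\dots,0,1)$; $V_n\cong F^{n-1}$ is its unipotent radical, $P_n=G_{n-1}\ltimes V_n$. $\psi_n(x_1,\dots,x_{n-1})=\exp(\sqrt{-1}\pi\,\mathrm{Re}\,x_{n-1})$ is a character of $V_n$, and also denotes the corresponding character of $\mathfrak{v}_n$. For a $\mathfrak{p}_n$-module $\pi$, $\Phi(\pi)=|\det|^{-1/2}\otimes\pi/\mathrm{Span}\{\alpha v-\psi_n(\alpha)v: v\in\pi,\alpha\in\mathfrak{v}_n\}$, a $\mathfrak{p}_{n-1}$-module; $E^k(\pi)=\Phi^{k-1}(\pi)$, a $\mathfrak{p}_{n-k+1}$-module, where $\mathfrak{p}_{n-k+1}=\mathfrak{g}_{n-k}\ltimes\mathfrak{v}_{n-k+1}$. $E^k_{HC}$ is its restriction to $\mathcal{M}_{HC}(G_n)$, the category of Harish-Chandra modules (finitely generated admissible $(\mathfrak{g}_n,K_n)$-modules, $K_n$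 a maximal compact subgroup of $G_n$). For a $\mathfrak{g}$-module $\tau$, $\mathcal{V}(\tau)\subset\mathfrak{g}^*$ is the zero set of the ideal of $\mathrm{Sym}(\mathfrak{g})$ generated by symbols of elements of the annihilator of $\tau$ in $U(\mathfrak{g})$. For $F=\mathbb{R}$, $\mathfrak{g}_n^*$ is identified with complex $n\times n$ matrices and $\mathrm{depth}(\tau)$ is the smallest $d$ with $A^d=0$ for all $A\in\mathcal{V}(\tau)$; for $F=\mathbb{C}$, $\mathfrak{g}_n=\mathfrak{gl}(n,\mathbb{C})\oplus\mathfrak{gl}(n,\mathbb{C})$ and $\mathrm{depth}(\tau)$ is the smallest $d$ with $A^d=B^d=0$ for all $(A,B)\in\mathcal{V}(\tau)$. $\mathcal{M}^d_{HC}(G_n)$ is the subcategory of modules of depth at most $d$. *)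

theory Defs
  imports "HOL-Analysis.Analysis" "HOL-Library.Poly_Mapping"
begin

section \<open>Matrices, the groups and the complexified Lie algebras\<close>

text \<open>An n by n matrix is a function that vanishes outside \<open>{..<n} \<times> {..<n}\<close>
  (indices start at 0). The Lie algebra embedding of gl(n) into gl(m) in the upper left corner is
  then an inclusion of sets.\<close>

type_synonym cmat = "nat \<Rightarrow> nat \<Rightarrow> complex"

definition mats :: "nat \<Rightarrow> cmat set" where
  "mats n = {A. \<forall>i j. A i j \<noteq> 0 \<longrightarrow> i < n \<and> j < n}"

definition mid :: "nat \<Rightarrow> cmat" where
  "mid n = (\<lambda>i j. if i = j \<and> i < n then 1 else 0)"

definition mmult :: "nat \<Rightarrow> cmat \<Rightarrow> cmat \<Rightarrow> cmat" where
  "mmult n A B = (\<lambda>i j. \<Sum>k<n. A i k * B k j)"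

primrec mpow :: "nat \<Rightarrow> cmat \<Rightarrow> nat \<Rightarrow> cmat" where
  "mpow n A 0 = mid n"
| "mpow n A (Suc k) = mmult n A (mpow n A k)"

definition minv :: "nat \<Rightarrow> cmat \<Rightarrow> cmat" where
  "minv n A = (THE B. B \<in> mats n \<and> mmult n A B = mid n \<and> mmult n B A = mid n)"

definition mexp :: "nat \<Rightarrow> cmat \<Rightarrow> cmat" where
  "mexp n A = (\<lambda>i j. suminf (\<lambda>r. mpow n A r i j / fact r))"

datatype base_field = RealF | ComplexF

text \<open>The embeddings of F into the complex numbers: the inclusion and, for the complex field,
  also the conjugation.\<close>

datatype emb = Incl | Conj

fun embs :: "base_field \<Rightarrow> emb set" where
  "embs RealF = {Incl}"
| "embs ComplexF = {Incl, Conj}"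

fun emb_mat :: "emb \<Rightarrow> cmat \<Rightarrow> cmat" where
  "emb_mat Incl A = A"
| "emb_mat Conj A = (\<lambda>i j. cnj (A i j))"

fun scalars :: "base_field \<Rightarrow> complex set" where
  "scalars RealF = \<real>"
| "scalars ComplexF = UNIV"

text \<open>The real Lie algebra gl(n,F) and the group GL(n,F).\<close>

definition real_gl :: "base_field \<Rightarrow> nat \<Rightarrow> cmat set" where
  "real_gl F n = {A \<in> mats n. \<forall>i j. A i j \<in> scalars F}"

definition GL :: "base_field \<Rightarrow> nat \<Rightarrow> cmat set" where
  "GL F n = {g \<in> real_gl F n. \<exists>h\<in>real_gl F n. mmult n g h = mid n \<and> mmult n h g = mid n}"

text \<open>The complexification of gl(n,F) is the direct sum of copies of gl(n) over the complex
  numbers, one for each embedding of F. So it is gl(n) for the real field and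
  gl(n) + gl(n) for the complex field; a real element A sits in it as A, respectively
  as (A, conjugate of A).\<close>

type_synonym glie = "emb \<Rightarrow> nat \<Rightarrow> nat \<Rightarrow> complex"

definition gl :: "base_field \<Rightarrow> nat \<Rightarrow> glie set" where
  "gl F n = {X. (\<forall>s. X s \<in> mats n) \<and> (\<forall>s. s \<notin> embs F \<longrightarrow> X s = (\<lambda>i j. 0))}"

definition complexify :: "base_field \<Rightarrow> cmat \<Rightarrow> glie" where
  "complexify F A = (\<lambda>s. if s \<in> embs F then emb_mat s A else (\<lambda>i j. 0))"

definition gadd :: "glie \<Rightarrow> glie \<Rightarrow> glie" where
  "gadd X Y = (\<lambda>s i j. X s i j + Y s i j)"

definition gscale :: "complex \<Rightarrow> glie \<Rightarrow> glie" where
  "gscale c X = (\<lambda>s i j. c * X s i j)"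

definition gbracket :: "nat \<Rightarrow> glie \<Rightarrow> glie \<Rightarrow> glie" where
  "gbracket n X Y = (\<lambda>s i j. mmult n (X s) (Y s) i j - mmult n (Y s) (X s) i j)"

definition Ad :: "base_field \<Rightarrow> nat \<Rightarrow> cmat \<Rightarrow> glie \<Rightarrow> glie" where
  "Ad F n g X = (\<lambda>s. if s \<in> embs F
     then mmult n (mmult n (emb_mat s g) (X s)) (emb_mat s (minv n g)) else (\<lambda>i j. 0))"

text \<open>Compactness is with respect to the product topology on functions, which on n by n
  matrices is the usual one.\<close>

definition compact_subgroup :: "base_field \<Rightarrow> nat \<Rightarrow> cmat set \<Rightarrow> bool" where
  "compact_subgroup F n K \<longleftrightarrow> K \<subseteq> GL F n \<and> compact K \<and> mid n \<in> K \<and>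
     (\<forall>g\<in>K. \<forall>h\<in>K. mmult n g h \<in> K) \<and> (\<forall>g\<in>K. minv n g \<in> K)"

definition maximal_compact :: "base_field \<Rightarrow> nat \<Rightarrow> cmat set \<Rightarrow> bool" where
  "maximal_compact F n K \<longleftrightarrow> compact_subgroup F n K \<and>
     (\<forall>K'. compact_subgroup F n K' \<and> K \<subseteq> K' \<longrightarrow> K' = K)"

definition lie_of :: "base_field \<Rightarrow> nat \<Rightarrow> cmat set \<Rightarrow> cmat set" where
  "lie_of F n K = {A \<in> real_gl F n. \<forall>t::real. mexp n (\<lambda>i j. of_real t * A i j) \<in> K}"


section \<open>Harish-Chandra modules\<close>

locale gl_module = vector_space smul
  for F :: base_field and n :: nat and smul :: "complex \<Rightarrow> 'v::ab_group_add \<Rightarrow> 'v"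
    and \<rho> :: "glie \<Rightarrow> 'v \<Rightarrow> 'v" +
  assumes act_linear: "X \<in> gl F n \<Longrightarrow> Vector_Spaces.linear smul smul (\<rho> X)"
    and act_add: "\<lbrakk>X \<in> gl F n; Y \<in> gl F n\<rbrakk> \<Longrightarrow> \<rho> (gadd X Y) v = \<rho> X v + \<rho> Y v"
    and act_scale: "X \<in> gl F n \<Longrightarrow> \<rho> (gscale c X) v = smul c (\<rho> X v)"
    and act_bracket: "\<lbrakk>X \<in> gl F n; Y \<in> gl F n\<rbrakk> \<Longrightarrow>
      \<rho> (gbracket n X Y) v = \<rho> X (\<rho> Y v) - \<rho> Y (\<rho> X v)"

text \<open>On a finite-dimensional space a map is continuous (differentiable) iff its compositions with
  all linear functionals are. As every vector is K-finite, continuity of the K-action and its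
  compatibility with the action of the Lie algebra of K are stated in this way, without choosing
  a topology on the span of the orbit.\<close>

locale gK_module = gl_module F n smul \<rho>
  for F :: base_field and n :: nat and K :: "cmat set"
    and smul :: "complex \<Rightarrow> 'v::ab_group_add \<Rightarrow> 'v"
    and \<rho> :: "glie \<Rightarrow> 'v \<Rightarrow> 'v" and \<kappa> :: "cmat \<Rightarrow> 'v \<Rightarrow> 'v" +
  assumes K_linear: "k \<in> K \<Longrightarrow> Vector_Spaces.linear smul smul (\<kappa> k)"
    and K_one: "\<kappa> (mid n) v = v"
    and K_mult: "\<lbrakk>k \<in> K; h \<in> K\<rbrakk> \<Longrightarrow> \<kappa> (mmult n k h) v = \<kappa> k (\<kappa> h v)"
    and K_finite: "\<exists>B. finite B \<and> (\<forall>k\<in>K. \<kappa> k v \<in> module.span smul B)"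
    and K_continuous: "Vector_Spaces.linear smul (*) (l :: 'v \<Rightarrow> complex) \<Longrightarrow>
      continuous_on K (\<lambda>k. l (\<kappa> k v))"
    and K_equivariant: "\<lbrakk>k \<in> K; X \<in> gl F n\<rbrakk> \<Longrightarrow> \<kappa> k (\<rho> X v) = \<rho> (Ad F n k X) (\<kappa> k v)"
    and K_derivative: "\<lbrakk>A \<in> lie_of F n K; Vector_Spaces.linear smul (*) (l :: 'v \<Rightarrow> complex)\<rbrakk> \<Longrightarrow>
      ((\<lambda>t::real. l (\<kappa> (mexp n (\<lambda>i j. of_real t * A i j)) v))
         has_vector_derivative l (\<rho> (complexify F A) v)) (at 0)"

definition K_submodule ::
  "cmat set \<Rightarrow> (complex \<Rightarrow> 'v::ab_group_add \<Rightarrow> 'v) \<Rightarrow> (cmat \<Rightarrow> 'v \<Rightarrow> 'v) \<Rightarrow> 'v set \<Rightarrow> bool" where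
  "K_submodule K smul \<kappa> W \<longleftrightarrow> module.subspace smul W \<and> (\<forall>k\<in>K. \<forall>w\<in>W. \<kappa> k w \<in> W)"

definition K_irreducible ::
  "cmat set \<Rightarrow> (complex \<Rightarrow> 'v::ab_group_add \<Rightarrow> 'v) \<Rightarrow> (cmat \<Rightarrow> 'v \<Rightarrow> 'v) \<Rightarrow> 'v set \<Rightarrow> bool" where
  "K_irreducible K smul \<kappa> W \<longleftrightarrow> K_submodule K smul \<kappa> W \<and> W \<noteq> {0} \<and>
     (\<forall>U. K_submodule K smul \<kappa> U \<and> U \<subseteq> W \<longrightarrow> U = {0} \<or> U = W)"

definition K_isomorphic ::
  "cmat set \<Rightarrow> (complex \<Rightarrow> 'v::ab_group_add \<Rightarrow> 'v) \<Rightarrow> (cmat \<Rightarrow> 'v \<Rightarrow> 'v) \<Rightarrow> 'v set \<Rightarrow> 'v set \<Rightarrow> bool" where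
  "K_isomorphic K smul \<kappa> W W' \<longleftrightarrow>
     (\<exists>f. Vector_Spaces.linear smul smul f \<and> bij_betw f W W' \<and>
          (\<forall>k\<in>K. \<forall>w\<in>W. f (\<kappa> k w) = \<kappa> k (f w)))"

text \<open>\<open>isotypic K smul \<kappa> W\<close> is the isotypic component of the irreducible K-module \<open>W\<close>. As \<open>W\<close> is
  finite-dimensional, its multiplicity is finite iff this component is finite-dimensional.\<close>

definition isotypic ::
  "cmat set \<Rightarrow> (complex \<Rightarrow> 'v::ab_group_add \<Rightarrow> 'v) \<Rightarrow> (cmat \<Rightarrow> 'v \<Rightarrow> 'v) \<Rightarrow> 'v set \<Rightarrow> 'v set" where
  "isotypic K smul \<kappa> W =
     module.span smul (\<Union>{W'. K_submodule K smul \<kappa> W' \<and> K_isomorphic K smul \<kappa> W W'})"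

locale harish_chandra_module = gK_module F n K smul \<rho> \<kappa>
  for F :: base_field and n :: nat and K :: "cmat set"
    and smul :: "complex \<Rightarrow> 'v::ab_group_add \<Rightarrow> 'v"
    and \<rho> :: "glie \<Rightarrow> 'v \<Rightarrow> 'v" and \<kappa> :: "cmat \<Rightarrow> 'v \<Rightarrow> 'v" +
  assumes finitely_generated: "\<exists>S. finite S \<and>
      (\<forall>U. module.subspace smul U \<and> S \<subseteq> U \<and> (\<forall>X\<in>gl F n. \<forall>u\<in>U. \<rho> X u \<in> U) \<longrightarrow> U = UNIV)"
    and admissible: "K_irreducible K smul \<kappa> W \<Longrightarrow>
      \<exists>B. finite B \<and> isotypic K smul \<kappa> W \<subseteq> module.span smul B"


section \<open>The enveloping algebra, annihilator varieties and depth\<close>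

text \<open>The letter (s, i, j) stands for the matrix unit E(i,j) in the summand s. The tensor algebra is
  the free algebra on the letters of the Lie algebra, its elements being finitely supported
  functions on words.\<close>

type_synonym letter = "emb \<times> nat \<times> nat"

type_synonym tens = "letter list \<Rightarrow>\<^sub>0 complex"

definition letters :: "base_field \<Rightarrow> nat \<Rightarrow> letter set" where
  "letters F n = embs F \<times> {..<n} \<times> {..<n}"

fun unit_of :: "letter \<Rightarrow> glie" where
  "unit_of (s, i, j) = (\<lambda>s' i' j'. if s' = s \<and> i' = i \<and> j' = j then 1 else 0)"

fun coord :: "glie \<Rightarrow> letter \<Rightarrow> complex" where
  "coord X (s, i, j) = X s i j"

definition tensor_algebra :: "base_field \<Rightarrow> nat \<Rightarrow> tens set" where
  "tensor_algebra F n = {t. \<forall>w\<in>Poly_Mapping.keys t. set w \<subseteq> letters F n}"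

text \<open>The two-sided ideal generated by all x y - y x - [x,y] is the linear span of the elements
  a (x y - y x - [x,y]) b with words a and b.\<close>

definition commutator_relation :: "base_field \<Rightarrow> nat \<Rightarrow> letter list \<Rightarrow> letter \<Rightarrow> letter \<Rightarrow> letter list \<Rightarrow> tens" where
  "commutator_relation F n a x y b =
     Poly_Mapping.single (a @ [x, y] @ b) 1 - Poly_Mapping.single (a @ [y, x] @ b) 1
     - (\<Sum>z\<in>letters F n. Poly_Mapping.single (a @ [z] @ b)
          (coord (gbracket n (unit_of x) (unit_of y)) z))"

definition commutator_ideal :: "base_field \<Rightarrow> nat \<Rightarrow> tens set" where
  "commutator_ideal F n = module.span (\<lambda>c. Poly_Mapping.map ((*) c))
     {commutator_relation F n a x y b | a x y b.
        set a \<subseteq> letters F n \<and> x \<in> letters F n \<and> y \<in> letters F n \<and> set b \<subseteq> letters F n}"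

definition u_class :: "base_field \<Rightarrow> nat \<Rightarrow> tens \<Rightarrow> tens set" where
  "u_class F n t = {t' \<in> tensor_algebra F n. t' - t \<in> commutator_ideal F n}"

text \<open>The universal enveloping algebra U(gl), and the image of the tensors of degree less than m in
  it, i.e. the step m - 1 of the standard filtration (which is 0 for m = 0).\<close>

definition enveloping :: "base_field \<Rightarrow> nat \<Rightarrow> tens set set" where
  "enveloping F n = u_class F n ` tensor_algebra F n"

definition enveloping_below :: "base_field \<Rightarrow> nat \<Rightarrow> nat \<Rightarrow> tens set set" where
  "enveloping_below F n m =
     u_class F n ` {t \<in> tensor_algebra F n. \<forall>w\<in>Poly_Mapping.keys t. length w < m}"

definition tens_act ::
  "(complex \<Rightarrow> 'v::ab_group_add \<Rightarrow> 'v) \<Rightarrow> (glie \<Rightarrow> 'v \<Rightarrow> 'v) \<Rightarrow> tens \<Rightarrow> 'v \<Rightarrow> 'v" where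
  "tens_act smul \<rho> t v = (\<Sum>w\<in>Poly_Mapping.keys t.
     smul (Poly_Mapping.lookup t w) (foldr (\<lambda>x. \<rho> (unit_of x)) w v))"

definition annihilator ::
  "base_field \<Rightarrow> nat \<Rightarrow> (complex \<Rightarrow> 'v::ab_group_add \<Rightarrow> 'v) \<Rightarrow> (glie \<Rightarrow> 'v \<Rightarrow> 'v) \<Rightarrow> tens set set" where
  "annihilator F n smul \<rho> = {u \<in> enveloping F n. \<forall>t\<in>u. \<forall>v. tens_act smul \<rho> t v = 0}"

text \<open>Sym(gl) is the polynomial ring in the letters.\<close>

type_synonym spoly = "(letter \<Rightarrow>\<^sub>0 nat) \<Rightarrow>\<^sub>0 complex"

definition sym_algebra :: "base_field \<Rightarrow> nat \<Rightarrow> spoly set" where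
  "sym_algebra F n = {p. \<forall>m\<in>Poly_Mapping.keys p. Poly_Mapping.keys m \<subseteq> letters F n}"

definition homogeneous_image :: "nat \<Rightarrow> tens \<Rightarrow> spoly" where
  "homogeneous_image m t = (\<Sum>w\<in>{w \<in> Poly_Mapping.keys t. length w = m}.
     Poly_Mapping.single (sum_list (map (\<lambda>x. Poly_Mapping.single x 1) w)) (Poly_Mapping.lookup t w))"

text \<open>The symbol of a nonzero u of order m is the image in Sym(gl) of the degree m component of any
  representative of u of degree at most m. By the Poincare-Birkhoff-Witt theorem this
  set has exactly one element for nonzero u; it is empty for u = 0.\<close>

definition symbols :: "base_field \<Rightarrow> nat \<Rightarrow> tens set \<Rightarrow> spoly set" where
  "symbols F n u = {homogeneous_image m t | m t.
     t \<in> u \<and> (\<forall>w\<in>Poly_Mapping.keys t. length w \<le> m) \<and> u \<notin> enveloping_below F n m}"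

definition sym_ideal :: "base_field \<Rightarrow> nat \<Rightarrow> spoly set \<Rightarrow> spoly set" where
  "sym_ideal F n S = {\<Sum>q\<in>Q. c q * q | Q c. finite Q \<and> Q \<subseteq> S \<and> (\<forall>q\<in>Q. c q \<in> sym_algebra F n)}"

text \<open>A linear form on gl is identified with an element A of gl by the trace pairing
  \<open>X \<mapsto> \<Sum>s. tr (A s X s)\<close>, whose value at E(i,j) in the summand s is \<open>A s j i\<close>.\<close>

fun trace_form :: "glie \<Rightarrow> letter \<Rightarrow> complex" where
  "trace_form A (s, i, j) = A s j i"

definition sym_eval :: "glie \<Rightarrow> spoly \<Rightarrow> complex" where
  "sym_eval A p = (\<Sum>m\<in>Poly_Mapping.keys p. Poly_Mapping.lookup p m *
     (\<Prod>x\<in>Poly_Mapping.keys m. trace_form A x ^ Poly_Mapping.lookup m x))"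

definition annihilator_variety ::
  "base_field \<Rightarrow> nat \<Rightarrow> (complex \<Rightarrow> 'v::ab_group_add \<Rightarrow> 'v) \<Rightarrow> (glie \<Rightarrow> 'v \<Rightarrow> 'v) \<Rightarrow> glie set" where
  "annihilator_variety F n smul \<rho> = {A \<in> gl F n.
     \<forall>p\<in>sym_ideal F n (\<Union>u\<in>annihilator F n smul \<rho>. symbols F n u). sym_eval A p = 0}"

text \<open>The value is \<open>\<infinity>\<close> if there is no such d.\<close>

definition depth ::
  "base_field \<Rightarrow> nat \<Rightarrow> (complex \<Rightarrow> 'v::ab_group_add \<Rightarrow> 'v) \<Rightarrow> (glie \<Rightarrow> 'v \<Rightarrow> 'v) \<Rightarrow> enat" where
  "depth F n smul \<rho> = Inf {enat d | d.
     \<forall>A\<in>annihilator_variety F n smul \<rho>. \<forall>s\<in>embs F. mpow n (A s) d = (\<lambda>i j. 0)}"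


section \<open>Derivatives\<close>

text \<open>\<open>p_alg F n\<close> is the complexified Lie algebra of the group of matrices with last row
  (0,...,0,1), and \<open>v_alg F n\<close> that of its unipotent radical.\<close>

definition p_alg :: "base_field \<Rightarrow> nat \<Rightarrow> glie set" where
  "p_alg F n = {X \<in> gl F n. \<forall>s j. X s (n - 1) j = 0}"

definition v_alg :: "base_field \<Rightarrow> nat \<Rightarrow> glie set" where
  "v_alg F n = {X \<in> p_alg F n. \<forall>s i j. j \<noteq> n - 1 \<longrightarrow> X s i j = 0}"

text \<open>\<open>re_ext F\<close> is the complex-linear extension of Re from F to its complexification,
  the complexification being coordinatized by the embeddings of F.\<close>

definition re_ext :: "base_field \<Rightarrow> (emb \<Rightarrow> complex) \<Rightarrow> complex" where
  "re_ext F x = (\<Sum>s\<in>embs F. x s) / of_nat (card (embs F))"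

text \<open>The differential of the character exp(i pi Re x(n-1)); the coordinate x(n-1) is the matrix entry
  in row n-1 and column n, counted from 1.\<close>

definition psi :: "base_field \<Rightarrow> nat \<Rightarrow> glie \<Rightarrow> complex" where
  "psi F n X = \<i> * of_real pi * re_ext F (\<lambda>s. X s (n - 2) (n - 1))"

text \<open>The differential of \<open>|det|\<close> on GL(m,F) at the identity: Re tr, extended to the
  complexification.\<close>

definition abs_det_diff :: "base_field \<Rightarrow> nat \<Rightarrow> glie \<Rightarrow> complex" where
  "abs_det_diff F m X = re_ext F (\<lambda>s. \<Sum>i<m. X s i i)"

text \<open>A module, on a linear subspace of an ambient vector space. The action is meaningful only for
  elements of the Lie algebra under consideration.\<close>

record 'v lie_mod =
  carr :: "'v set"
  act :: "glie \<Rightarrow> 'v \<Rightarrow> 'v"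

text \<open>The quotient C/W is realized on a linear complement D of W in C: the projection D \<open>\<rightarrow>\<close> C/W is an
  isomorphism, and a coset v + W is represented by its unique element in D. So iterated
  quotients stay in the same ambient space.\<close>

definition complement :: "(complex \<Rightarrow> 'v::ab_group_add \<Rightarrow> 'v) \<Rightarrow> 'v set \<Rightarrow> 'v set \<Rightarrow> 'v set" where
  "complement smul C W = (SOME D. module.subspace smul D \<and> D \<subseteq> C \<and> D \<inter> W = {0} \<and>
     (\<forall>v\<in>C. \<exists>x\<in>D. v - x \<in> W))"

definition coset_rep :: "(complex \<Rightarrow> 'v::ab_group_add \<Rightarrow> 'v) \<Rightarrow> 'v set \<Rightarrow> 'v set \<Rightarrow> 'v \<Rightarrow> 'v" where
  "coset_rep smul C W v = (THE x. x \<in> complement smul C W \<and> v - x \<in> W)"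

definition quotient_mod :: "(complex \<Rightarrow> 'v::ab_group_add \<Rightarrow> 'v) \<Rightarrow> 'v lie_mod \<Rightarrow> 'v set \<Rightarrow> 'v lie_mod" where
  "quotient_mod smul M W = \<lparr>carr = complement smul (carr M) W,
     act = (\<lambda>X v. coset_rep smul (carr M) W (act M X v))\<rparr>"

definition twist :: "(complex \<Rightarrow> 'v::ab_group_add \<Rightarrow> 'v) \<Rightarrow> (glie \<Rightarrow> complex) \<Rightarrow> 'v lie_mod \<Rightarrow> 'v lie_mod" where
  "twist smul ch M = \<lparr>carr = carr M, act = (\<lambda>X v. act M X v + smul (ch X) v)\<rparr>"

definition psi_span :: "base_field \<Rightarrow> nat \<Rightarrow> (complex \<Rightarrow> 'v::ab_group_add \<Rightarrow> 'v) \<Rightarrow> 'v lie_mod \<Rightarrow> 'v set" where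
  "psi_span F n smul M = module.span smul
     {act M \<alpha> v - smul (psi F n \<alpha>) v | \<alpha> v. \<alpha> \<in> v_alg F n \<and> v \<in> carr M}"

text \<open>\<open>Phi F n\<close> maps modules over \<open>p_alg F n\<close> to modules over \<open>p_alg F (n - 1)\<close>.\<close>

definition Phi :: "base_field \<Rightarrow> nat \<Rightarrow> (complex \<Rightarrow> 'v::ab_group_add \<Rightarrow> 'v) \<Rightarrow> 'v lie_mod \<Rightarrow> 'v lie_mod" where
  "Phi F n smul M =
     twist smul (\<lambda>X. - (1/2) * abs_det_diff F (n - 1) X) (quotient_mod smul M (psi_span F n smul M))"

primrec Phi_iter ::
  "base_field \<Rightarrow> nat \<Rightarrow> (complex \<Rightarrow> 'v::ab_group_add \<Rightarrow> 'v) \<Rightarrow> nat \<Rightarrow> 'v lie_mod \<Rightarrow> 'v lie_mod" where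
  "Phi_iter F n smul 0 M = M"
| "Phi_iter F n smul (Suc k) M = Phi F (n - k) smul (Phi_iter F n smul k M)"

definition E_deriv ::
  "base_field \<Rightarrow> nat \<Rightarrow> (complex \<Rightarrow> 'v::ab_group_add \<Rightarrow> 'v) \<Rightarrow> nat \<Rightarrow> 'v lie_mod \<Rightarrow> 'v lie_mod" where
  "E_deriv F n smul k M = Phi_iter F n smul (k - 1) M"

definition E_HC ::
  "base_field \<Rightarrow> nat \<Rightarrow> (complex \<Rightarrow> 'v::ab_group_add \<Rightarrow> 'v) \<Rightarrow> nat \<Rightarrow> (glie \<Rightarrow> 'v \<Rightarrow> 'v) \<Rightarrow> 'v lie_mod" where
  "E_HC F n smul k \<rho> = E_deriv F n smul k \<lparr>carr = UNIV, act = \<rho>\<rparr>"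

end

theory Submission
  imports Defs "HOL-Computational_Algebra.Fundamental_Theorem_Algebra"
begin

text \<open>Put \<open>p = n - d\<close> and count rows and columns from 0. The module \<open>E\<^sup>d(\<pi>)\<close> is, up to a twist by a
character that is trivial on strictly triangular matrices, the largest quotient of \<open>\<pi>\<close> on which the
columns to the right of column \<open>p\<close>, i.e. the nilpotent algebra spanned by the \<open>E(i,j)\<close> with \<open>i < j\<close> and
\<open>p < j\<close>, act by a character that is nonzero exactly on the \<open>E(j-1,j)\<close> (\<open>Phi_iter_derivative_quotient\<close>).
Let \<open>q\<close> be the projection from \<open>\<pi>\<close>. The elements \<open>E(i,p)\<close> with \<open>i < p\<close> span the algebra of the claim, and they commute,
so it suffices to find for each of them a power that is killed by \<open>q\<close> (\<open>column_act_nilpotent\<close>).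

The depth condition says that the entry \<open>f(A) = (A\<^sup>d)(n-1,i)\<close> vanishes on the zero set of the symbols
of the annihilator \<open>I\<close> of \<open>\<pi>\<close>. By the Nullstellensatz a power \<open>f\<^sup>k\<close> lies in the ideal of the symbols,
so \<open>f\<^sup>k\<close> is itself the leading term of an element \<open>t\<close> of \<open>I\<close> (\<open>var_mpow_power_in_symbol_ideal\<close>).
As a polynomial, \<open>f\<close> is the sum over all paths of length \<open>d\<close> from \<open>i\<close> to \<open>n-1\<close>. On the linear forms
that extend the character, only the path \<open>i, p, p+1, ..., n-1\<close> survives, which
contributes a nonzero constant times \<open>E(i,p)\<close>. So the leading term of \<open>t\<close> acts on the quotient
as a nonzero multiple of \<open>E(i,p)\<^sup>k\<close>, while \<open>t\<close> itself acts by 0.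

It remains to see that the lower terms of \<open>t\<close> and the commutators that arise from reordering
do not matter. Two gradings of \<open>U(\<gg>)\<close> achieve this: the block weight \<open>\<beta>\<close>, which counts with sign how
often a word passes between the first \<open>p\<close> coordinates and the others, and the Kazhdan degree
\<open>\<delta>\<close>, for which \<open>E(j-1,j)\<close> with \<open>j > p\<close> has degree 0 and \<open>E(i,p)\<close> with \<open>i < p\<close> has degree 1.
As \<open>I\<close> is a two-sided ideal, \<open>t\<close> may be replaced by a weight component
(\<open>weight_component_annihilates\<close>). Then its leading words have \<open>\<delta> = \<beta> = k\<close> and
its shorter words have \<open>\<delta> < \<beta>\<close>. A word with \<open>\<delta> < \<beta>\<close> is killed by \<open>q\<close>: once the letters on which
the character is defined are moved to the left and evaluated there, each remaining letter has
\<open>\<beta> \<le> \<delta>\<close> (\<open>low_words_vanish\<close>). Since a commutator lowers \<open>\<delta>\<close> by one and preserves \<open>\<beta>\<close>, the words with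
\<open>\<delta> = \<beta>\<close> may be evaluated as if their letters commuted (\<open>column_letter_nilpotent\<close>).\<close>

section \<open>A Nullstellensatz over the complex numbers\<close>

definition is_ideal :: "'r::comm_ring_1 set \<Rightarrow> bool" where
  "is_ideal J \<longleftrightarrow> 0 \<in> J \<and> (\<forall>a\<in>J. \<forall>b\<in>J. a + b \<in> J) \<and> (\<forall>a\<in>J. \<forall>r. r * a \<in> J)"

lemma is_idealD:
  assumes "is_ideal J"
  shows ideal_zero: "0 \<in> J"
    and ideal_add: "a \<in> J \<Longrightarrow> b \<in> J \<Longrightarrow> a + b \<in> J"
    and ideal_mult: "a \<in> J \<Longrightarrow> r * a \<in> J"
    and ideal_diff: "a \<in> J \<Longrightarrow> b \<in> J \<Longrightarrow> a - b \<in> J"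
    and ideal_sum: "(\<And>x. x \<in> T \<Longrightarrow> h x \<in> J) \<Longrightarrow> sum h T \<in> J"
proof -
  show z: "0 \<in> J" and add: "a \<in> J \<Longrightarrow> b \<in> J \<Longrightarrow> a + b \<in> J"
    and mult: "a \<in> J \<Longrightarrow> r * a \<in> J" for a b r
    using assms by (auto simp: is_ideal_def)
  show "a \<in> J \<Longrightarrow> b \<in> J \<Longrightarrow> a - b \<in> J"
    using add[of a "- b"] mult[of b "- 1"] by simp
  show "(\<And>x. x \<in> T \<Longrightarrow> h x \<in> J) \<Longrightarrow> sum h T \<in> J"
    by (induction T rule: infinite_finite_induct) (auto simp: z add)
qed

text \<open>Zorn's lemma. The last property expresses maximality: modulo \<open>P\<close>, every nonzero element
becomes invertible once \<open>f\<close> is inverted.\<close>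

lemma maximal_ideal_avoiding_powers:
  fixes f :: "'r::comm_ring_1"
  assumes J: "is_ideal J" and f: "\<And>k. f ^ k \<notin> J"
  obtains P where "is_ideal P" "J \<subseteq> P" "\<And>k. f ^ k \<notin> P"
    "\<And>g. g \<notin> P \<Longrightarrow> \<exists>k r. f ^ k - r * g \<in> P"
proof -
  let ?A = "{P. is_ideal P \<and> J \<subseteq> P \<and> (\<forall>k. f ^ k \<notin> P)}"
  have ne: "?A \<noteq> {}" using J f by blast
  have ch: "\<Union>\<C> \<in> ?A" if ne: "\<C> \<noteq> {}" and c: "subset.chain ?A \<C>" for \<C>
  proof -
    have sub: "\<C> \<subseteq> ?A" and tot: "\<And>X Y. X \<in> \<C> \<Longrightarrow> Y \<in> \<C> \<Longrightarrow> X \<subseteq> Y \<or> Y \<subseteq> X"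
      using c by (auto simp: subset_chain_def)
    have add: "a + b \<in> \<Union>\<C>" if ab: "a \<in> \<Union>\<C>" "b \<in> \<Union>\<C>" for a b
    proof -
      obtain X Y where XY: "X \<in> \<C>" "Y \<in> \<C>" "a \<in> X" "b \<in> Y" using ab by blast
      then obtain Z where "Z \<in> \<C>" "a \<in> Z" "b \<in> Z" using tot[of X Y] by blast
      then show ?thesis using sub ideal_add[of Z a b] by blast
    qed
    have "is_ideal (\<Union>\<C>)"
      unfolding is_ideal_def
    proof (intro conjI ballI allI)
      show "0 \<in> \<Union>\<C>" using sub ne ideal_zero by blast
      show "a + b \<in> \<Union>\<C>" if "a \<in> \<Union>\<C>" "b \<in> \<Union>\<C>" for a b using add that .
      show "r * a \<in> \<Union>\<C>" if "a \<in> \<Union>\<C>" for a r using sub ideal_mult that by blast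
    qed
    then show ?thesis using sub ne by blast
  qed
  have "\<exists>P\<in>?A. \<forall>X\<in>?A. P \<subseteq> X \<longrightarrow> X = P"
    by (rule subset_Zorn_nonempty[OF ne]) (rule ch)
  then obtain P where P: "P \<in> ?A" and max: "\<forall>X\<in>?A. P \<subseteq> X \<longrightarrow> X = P"
    by (elim bexE)
  have I: "is_ideal P" using P by simp
  have "\<exists>k r. f ^ k - r * g \<in> P" if g: "g \<notin> P" for g
  proof (rule ccontr)
    assume no: "\<nexists>k r. f ^ k - r * g \<in> P"
    let ?Q = "{a. \<exists>r. a - r * g \<in> P}"
    have PQ: "P \<subseteq> ?Q"
    proof
      fix a assume "a \<in> P"
      then have "a - 0 * g \<in> P" by simp
      then show "a \<in> ?Q" by blast
    qed
    have "is_ideal ?Q"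
      unfolding is_ideal_def
    proof (intro conjI ballI allI)
      show "0 \<in> ?Q" using PQ ideal_zero[OF I] by blast
    next
      fix a b assume "a \<in> ?Q" "b \<in> ?Q"
      then obtain r s where "a - r * g \<in> P" "b - s * g \<in> P" by blast
      from ideal_add[OF I this] have "(a + b) - (r + s) * g \<in> P" by (simp add: algebra_simps)
      then show "a + b \<in> ?Q" by blast
    next
      fix a t assume "a \<in> ?Q"
      then obtain r where "a - r * g \<in> P" by blast
      from ideal_mult[OF I this, of t] have "t * a - (t * r) * g \<in> P" by (simp add: algebra_simps)
      then show "t * a \<in> ?Q" by blast
    qed
    moreover have "J \<subseteq> ?Q" using P PQ by blast
    moreover have "\<forall>k. f ^ k \<notin> ?Q" using no by blast
    ultimately have "?Q = P" using bspec[OF max, of ?Q] PQ by simp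
    moreover have "g - 1 * g \<in> P" using ideal_zero[OF I] by simp
    then have "g \<in> ?Q" by blast
    ultimately show False using g by blast
  qed
  then show ?thesis using that[of P] P by simp
qed

text \<open>The Nullstellensatz for an algebra of countable dimension over the complex numbers, which has a
short proof because the field is uncountable. Let \<open>P\<close> be maximal among the ideals containing \<open>J\<close> that avoid
the powers of \<open>f\<close>. If no \<open>x - a\<close> lay in \<open>P\<close>, every \<open>x - a\<close> would have an inverse
\<open>g\<^sub>a / f\<^sup>k\<close> modulo \<open>P\<close>. Uncountably many of the \<open>g\<^sub>a\<close> would share the same \<open>k\<close> and lie in one
finite-dimensional subspace; clearing denominators in a linear relation between them would give a nonzero
polynomial in \<open>x\<close> that lies in \<open>P\<close>, hence, by the fundamental theorem of algebra, some \<open>x - a\<close> in \<open>P\<close>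
after all. So every element is congruent to a scalar modulo \<open>P\<close>.\<close>

lemma countable_dimension_nullstellensatz:
  fixes C :: "complex \<Rightarrow> 'r::comm_ring_1" and B :: "nat \<Rightarrow> 'r"
  assumes C_add: "\<And>a b. C (a + b) = C a + C b" and C_mult: "\<And>a b. C (a * b) = C a * C b"
    and C_one: "C 1 = 1"
    and spanning: "\<And>x. \<exists>N c. x = (\<Sum>i<N. C (c i) * B i)"
    and J: "is_ideal J" and f: "\<And>k. f ^ k \<notin> J"
  obtains ev :: "'r \<Rightarrow> complex" where
    "\<And>x y. ev (x + y) = ev x + ev y" "\<And>x y. ev (x * y) = ev x * ev y" "\<And>c. ev (C c) = c"
    "\<And>x. x \<in> J \<Longrightarrow> ev x = 0" "ev f \<noteq> 0"
proof -
  have C_zero: "C 0 = 0" using C_add[of 0 0] by simp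
  have C_minus: "C (- a) = - C a" for a using C_add[of a "- a"] C_zero by (simp add: eq_neg_iff_add_eq_0 add.commute)
  have C_diff: "C (a - b) = C a - C b" for a b using C_add[of a "- b"] C_minus by simp
  interpret vector_space "\<lambda>c x. C c * x"
    by unfold_locales (simp_all add: C_add C_mult C_one algebra_simps)
  obtain P where P: "is_ideal P" and JP: "J \<subseteq> P" and fP: "\<And>k. f ^ k \<notin> P"
    and max: "\<And>g. g \<notin> P \<Longrightarrow> \<exists>k r. f ^ k - r * g \<in> P"
    using maximal_ideal_avoiding_powers[OF J f] by metis
  note I = is_idealD[OF P]
  have one: "1 \<notin> P" using fP[of 0] by simp
  have unit: "C c * x \<in> P \<Longrightarrow> c \<noteq> 0 \<Longrightarrow> x \<in> P" for c x
    using I(3)[of "C c * x" "C (inverse c)"] C_mult[of "inverse c" c] C_one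
    by (simp add: mult.assoc[symmetric])
  have prime: "g \<in> P \<or> h \<in> P" if "g * h \<in> P" for g h
  proof (rule ccontr)
    assume "\<not> (g \<in> P \<or> h \<in> P)"
    then obtain k r l s where 1: "f ^ k - r * g \<in> P" and 2: "f ^ l - s * h \<in> P" using max by metis
    have "f ^ (k + l) = f ^ l * (f ^ k - r * g) + (r * g) * (f ^ l - s * h) + (r * s) * (g * h)"
      by (simp add: algebra_simps power_add)
    also have "\<dots> \<in> P" using I(2,3) 1 2 that by blast
    finally show False using fP by blast
  qed
  have attains: "\<exists>a. x - C a \<in> P" for x
  proof (rule ccontr)
    assume no: "\<nexists>a. x - C a \<in> P"
    then have "\<forall>a. \<exists>k g. f ^ k - g * (x - C a) \<in> P" using max by blast
    then obtain k g where kg: "\<And>a. f ^ k a - g a * (x - C a) \<in> P" by metis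
    \<comment> \<open>The evaluation of a complex polynomial at \<open>x\<close>.\<close>
    define E where "E = (\<lambda>q. fold_coeffs (\<lambda>a b. C a + x * b) q 0)"
    have E_0: "E 0 = 0" by (simp add: E_def)
    have E_pCons: "E (pCons a q) = C a + x * E q" for a q
      by (cases "q = 0 \<and> a = 0") (auto simp: E_def C_zero)
    have E_add: "E (p + q) = E p + E q" for p q
      by (induction p q rule: poly_induct2) (simp_all add: E_0 E_pCons C_add algebra_simps)
    have E_smult: "E (smult c q) = C c * E q" for c q
      by (induction q) (simp_all add: E_0 E_pCons C_mult algebra_simps)
    have E_lin: "E ([:- l, 1:] * q) = (x - C l) * E q" for l q
    proof -
      have "[:- l, 1:] * q = pCons 0 q + smult (- l) q" by simp
      then show ?thesis by (simp only: E_add E_smult E_pCons C_zero C_minus) (simp add: algebra_simps)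
    qed
    have E_one: "E 1 = 1" by (simp add: one_pCons E_pCons E_0 C_one)
    have E_prod: "E (\<Prod>l\<in>T. [:- l, 1:]) = (\<Prod>l\<in>T. x - C l)" if "finite T" for T
      using that by (induction T) (simp_all add: E_one E_lin del: mult_pCons_left)
    have E_sum: "E (sum h T) = (\<Sum>t\<in>T. E (h t))" for h :: "complex \<Rightarrow> complex poly" and T
      by (induction T rule: infinite_finite_induct) (simp_all add: E_0 E_add)
    have E_notin: "q \<noteq> 0 \<Longrightarrow> E q \<notin> P" for q
    proof (induction "degree q" arbitrary: q)
      case 0
      then obtain c where q: "q = [:c:]" by (metis degree_eq_zeroE)
      then have "E q = C c * 1" by (simp add: E_pCons E_0)
      then show ?case using unit[of c 1] one q 0 by auto
    next
      case (Suc m)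
      then have "\<not> constant (poly q)" by (simp add: constant_degree)
      then obtain r where "poly q r = 0" using fundamental_theorem_of_algebra by blast
      then obtain q' where q: "q = [:- r, 1:] * q'" by (metis dvdE poly_eq_0_iff_dvd)
      have q0: "q' \<noteq> 0" using Suc(3) q by auto
      have "degree q = degree [:- r, 1:] + degree q'"
        unfolding q by (rule degree_mult_eq) (use q0 in auto)
      then have "m = degree q'" using Suc(2) by simp
      then have "E q' \<notin> P" using Suc(1) q0 by blast
      then show ?case using no prime[of "x - C r" "E q'"] unfolding q E_lin by blast
    qed
    have "\<exists>N. g a \<in> span (B ` {..<N})" for a
    proof -
      obtain N c where "g a = (\<Sum>i<N. C (c i) * B i)" using spanning by blast
      also have "\<dots> \<in> span (B ` {..<N})"
        by (intro span_sum span_scale span_base) auto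
      finally show ?thesis by blast
    qed
    then obtain N where N: "\<And>a. g a \<in> span (B ` {..<N a})" by metis
    have "uncountable (UNIV :: complex set)" by (rule uncountable_UNIV_complex)
    moreover have "UNIV = (\<Union>z\<in>UNIV. {a. (k a, N a) = z})" by auto
    ultimately obtain z where "\<not> countable {a. (k a, N a) = z}"
      using countable_UN[of UNIV "\<lambda>z. {a. (k a, N a) = z}"] by (metis countableI_type)
    then obtain k0 N0 where inf: "infinite {a. k a = k0 \<and> N a = N0}"
      by (cases z) (auto dest: countable_finite)
    let ?S = "{a. k a = k0 \<and> N a = N0}"
    have inj: "inj_on g ?S"
    proof (rule inj_onI, rule ccontr)
      fix a b assume ab: "a \<in> ?S" "b \<in> ?S" "g a = g b" "a \<noteq> b"
      have "(f ^ k0 - g b * (x - C b)) - (f ^ k0 - g a * (x - C a)) \<in> P"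
        using I(4)[OF kg[of b] kg[of a]] ab(1,2) by simp
      then have "C (b - a) * g a \<in> P" using ab(3) by (simp add: C_diff algebra_simps)
      then have "g a \<in> P" using unit ab(4) by fastforce
      then have "f ^ k a - g a * (x - C a) + (x - C a) * g a \<in> P" using kg[of a] I(2,3) by blast
      then show False using fP[of "k a"] by (simp add: algebra_simps)
    qed
    have "dependent (g ` ?S)"
    proof (rule ccontr)
      assume "independent (g ` ?S)"
      then have "finite (g ` ?S)"
        using independent_span_bound[of "B ` {..<N0}" "g ` ?S"] N by fastforce
      then show False using inf inj finite_imageD by blast
    qed
    then obtain U u where U: "finite U" "U \<subseteq> g ` ?S" "(\<Sum>v\<in>U. C (u v) * v) = 0" "\<exists>v\<in>U. u v \<noteq> 0"
      unfolding dependent_explicit by blast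
    obtain T where T: "T \<subseteq> ?S" "finite T" "U = g ` T"
      using finite_subset_image[OF U(1,2)] by (elim exE conjE)
    have injT: "inj_on g T" using inj T(1) by (rule inj_on_subset)
    define c where "c = u \<circ> g"
    have sum0: "(\<Sum>a\<in>T. C (c a) * g a) = 0"
      using U(3) unfolding T(3) by (simp add: sum.reindex[OF injT] c_def)
    obtain b where b: "b \<in> T" "c b \<noteq> 0" using U(4) T(3) by (auto simp: c_def)
    \<comment> \<open>The numerator of \<open>\<Sum>a\<in>T. c a / (X - a)\<close>; its value at \<open>b\<close> is
      \<open>c b * (\<Prod>l\<in>T - {b}. b - l)\<close>, so it is not zero.\<close>
    define q where "q = (\<Sum>a\<in>T. smult (c a) (\<Prod>l\<in>T - {a}. [:- l, 1:]))"
    have "poly q b = (\<Sum>a\<in>T. c a * (\<Prod>l\<in>T - {a}. b - l))"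
      by (simp add: q_def poly_sum poly_prod)
    also have "\<dots> = (\<Sum>a\<in>{b}. c a * (\<Prod>l\<in>T - {a}. b - l))"
      by (rule sum.mono_neutral_right) (use T(2) b(1) in auto)
    also have "\<dots> \<noteq> 0" using b T(2) by auto
    finally have "q \<noteq> 0" by auto
    have "f ^ k0 * E q = (\<Sum>a\<in>T. C (c a) * (\<Prod>l\<in>T - {a}. x - C l) * (f ^ k0 - g a * (x - C a)))
        + (\<Prod>l\<in>T. x - C l) * (\<Sum>a\<in>T. C (c a) * g a)"
    proof -
      have "(\<Prod>l\<in>T. x - C l) = (x - C a) * (\<Prod>l\<in>T - {a}. x - C l)" if "a \<in> T" for a
        using T(2) that by (rule prod.remove)
      then have "(\<Prod>l\<in>T. x - C l) * (\<Sum>a\<in>T. C (c a) * g a)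
          = (\<Sum>a\<in>T. (x - C a) * (\<Prod>l\<in>T - {a}. x - C l) * (C (c a) * g a))"
        unfolding sum_distrib_left by (intro sum.cong) auto
      then show ?thesis
        unfolding q_def E_sum sum_distrib_left
        by (simp add: E_smult E_prod T(2) sum.distrib[symmetric] algebra_simps)
    qed
    also have "\<dots> = (\<Sum>a\<in>T. C (c a) * (\<Prod>l\<in>T - {a}. x - C l) * (f ^ k0 - g a * (x - C a)))"
      by (simp add: sum0)
    also have "\<dots> \<in> P"
    proof (intro I(5) I(3))
      fix a assume "a \<in> T"
      then have "k a = k0" using T(1) by auto
      then show "f ^ k0 - g a * (x - C a) \<in> P" using kg[of a] by simp
    qed
    finally show False using prime fP E_notin[OF \<open>q \<noteq> 0\<close>] by blast
  qed
  define ev where "ev = (\<lambda>x. SOME a. x - C a \<in> P)"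
  have evP: "x - C (ev x) \<in> P" for x unfolding ev_def using attains by (rule someI_ex)
  have evI: "ev x = a" if "x - C a \<in> P" for x a
  proof (rule ccontr)
    assume "ev x \<noteq> a"
    moreover have "C (ev x - a) * 1 \<in> P" using I(4)[OF that evP[of x]] by (simp add: C_diff)
    ultimately show False using unit one by force
  qed
  show ?thesis
  proof
    fix x y
    show "ev (x + y) = ev x + ev y"
      using I(2)[OF evP[of x] evP[of y]] by (intro evI) (simp add: C_add algebra_simps)
    have "y * (x - C (ev x)) + C (ev x) * (y - C (ev y)) \<in> P" using I(2,3) evP by blast
    then show "ev (x * y) = ev x * ev y" by (intro evI) (simp add: C_mult algebra_simps)
    show "ev (C c) = c" for c by (rule evI) (simp add: I(1))
    show "x \<in> J \<Longrightarrow> ev x = 0" using JP by (intro evI) (auto simp: C_zero)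
    show "ev f \<noteq> 0" using evP[of f] fP[of 1] by (auto simp: C_zero)
  qed
qed

section \<open>Polynomials in the matrix units\<close>

instance emb :: countable by countable_datatype

definition var :: "letter \<Rightarrow> spoly" where
  "var x = Poly_Mapping.single (Poly_Mapping.single x 1) 1"

text \<open>The commutative monomial of a word.\<close>

definition word_mon :: "letter list \<Rightarrow> letter \<Rightarrow>\<^sub>0 nat" where
  "word_mon w = sum_list (map (\<lambda>x. Poly_Mapping.single x 1) w)"

lemma word_mon_Nil [simp]: "word_mon [] = 0"
  and word_mon_Cons [simp]: "word_mon (x # w) = Poly_Mapping.single x 1 + word_mon w"
  and word_mon_append [simp]: "word_mon (a @ b) = word_mon a + word_mon b"
  by (simp_all add: word_mon_def)

lemma lookup_word_mon: "Poly_Mapping.lookup (word_mon w) x = count (mset w) x"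
  by (induction w) (auto simp: lookup_add lookup_single)

lemma keys_word_mon: "Poly_Mapping.keys (word_mon w) = set w"
  by (auto simp: in_keys_iff lookup_word_mon)

lemma word_mon_eq_iff: "word_mon w = word_mon w' \<longleftrightarrow> mset w = mset w'"
  by (auto simp: poly_mapping_eq_iff fun_eq_iff lookup_word_mon multiset_eq_iff)

lemma poly_mapping_sum_single: "t = (\<Sum>k\<in>Poly_Mapping.keys t. Poly_Mapping.single k (Poly_Mapping.lookup t k))"
proof (rule poly_mapping_eqI)
  fix k
  show "Poly_Mapping.lookup t k = Poly_Mapping.lookup
      (\<Sum>k\<in>Poly_Mapping.keys t. Poly_Mapping.single k (Poly_Mapping.lookup t k)) k"
    by (auto simp: lookup_sum lookup_single when_def in_keys_iff)
qed

lemma single_times_eq_mono: "Poly_Mapping.single x k = word_mon (replicate k x)"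
proof (induction k)
  case (Suc k)
  have "Poly_Mapping.single x (Suc k) = Poly_Mapping.single x 1 + Poly_Mapping.single x k"
    by (simp add: single_add[symmetric])
  then show ?case using Suc by simp
qed simp

lemma word_mon_surj: "\<exists>w. e = word_mon w"
proof -
  have "\<exists>w. (\<Sum>x\<in>T. Poly_Mapping.single x (Poly_Mapping.lookup e x)) = word_mon w" if "finite T" for T
    using that
  proof induction
    case empty
    show ?case by (rule exI[of _ "[]"]) simp
  next
    case (insert x T)
    then obtain w where "(\<Sum>x\<in>T. Poly_Mapping.single x (Poly_Mapping.lookup e x)) = word_mon w" by blast
    then have "(\<Sum>x\<in>insert x T. Poly_Mapping.single x (Poly_Mapping.lookup e x))
        = word_mon (replicate (Poly_Mapping.lookup e x) x @ w)"
      using insert by (simp add: single_times_eq_mono)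
    then show ?case by blast
  qed
  from this[OF finite_keys[of e]] show ?thesis
    unfolding poly_mapping_sum_single[symmetric] .
qed

lemma word_mon_diff:
  assumes "word_mon a + e = word_mon w"
  obtains b where "e = word_mon b" "mset w = mset (a @ b)"
  using word_mon_surj[of e] assms by (metis word_mon_append word_mon_eq_iff)

lemma lookup_single_mult:
  fixes p :: spoly
  shows "Poly_Mapping.lookup (Poly_Mapping.single e c * p) (e + e') = c * Poly_Mapping.lookup p e'"
    and "(\<And>e'. e'' \<noteq> e + e') \<Longrightarrow> Poly_Mapping.lookup (Poly_Mapping.single e c * p) e'' = 0"
proof -
  have *: "Poly_Mapping.single e c * p =
      (\<Sum>k\<in>Poly_Mapping.keys p. Poly_Mapping.single (e + k) (c * Poly_Mapping.lookup p k))"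
    by (subst poly_mapping_sum_single[of p]) (simp add: sum_distrib_left mult_single)
  show "Poly_Mapping.lookup (Poly_Mapping.single e c * p) (e + e') = c * Poly_Mapping.lookup p e'"
    unfolding * by (auto simp: lookup_sum lookup_single when_def in_keys_iff)
  show "Poly_Mapping.lookup (Poly_Mapping.single e c * p) e'' = 0" if "\<And>e'. e'' \<noteq> e + e'"
    unfolding * using that[symmetric] by (simp add: lookup_sum lookup_single)
qed

lemma countable_monomials: "countable (UNIV :: (letter \<Rightarrow>\<^sub>0 nat) set)"
proof -
  have "(UNIV :: (letter \<Rightarrow>\<^sub>0 nat) set) = range word_mon" using word_mon_surj by blast
  then show ?thesis by (metis countableI_type countable_image)
qed

lemma spoly_spanning:
  "\<exists>N c. (x::spoly) = (\<Sum>i<N. Poly_Mapping.single 0 (c i) * Poly_Mapping.single (from_nat_into UNIV i) 1)"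
proof -
  define \<sigma> :: "nat \<Rightarrow> letter \<Rightarrow>\<^sub>0 nat" where "\<sigma> = from_nat_into UNIV"
  define \<tau> :: "(letter \<Rightarrow>\<^sub>0 nat) \<Rightarrow> nat" where "\<tau> = to_nat_on UNIV"
  have \<sigma>\<tau>: "\<sigma> (\<tau> e) = e" for e
    unfolding \<sigma>_def \<tau>_def by (rule from_nat_into_to_nat_on[OF countable_monomials]) simp
  have inj: "inj_on \<tau> T" for T by (metis inj_onI \<sigma>\<tau>)
  let ?T = "\<tau> ` Poly_Mapping.keys x"
  define c where "c = (\<lambda>i. if i \<in> ?T then Poly_Mapping.lookup x (\<sigma> i) else 0)"
  obtain N where N: "?T \<subseteq> {..<N}" using finite_nat_iff_bounded[of ?T] by auto
  have "x = (\<Sum>e\<in>Poly_Mapping.keys x. Poly_Mapping.single e (Poly_Mapping.lookup x e))"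
    by (rule poly_mapping_sum_single)
  also have "\<dots> = (\<Sum>i\<in>?T. Poly_Mapping.single (\<sigma> i) (Poly_Mapping.lookup x (\<sigma> i)))"
    by (simp add: sum.reindex[OF inj] \<sigma>\<tau>)
  also have "\<dots> = (\<Sum>i\<in>?T. Poly_Mapping.single 0 (c i) * Poly_Mapping.single (\<sigma> i) 1)"
    by (rule sum.cong) (simp_all add: c_def mult_single)
  also have "\<dots> = (\<Sum>i<N. Poly_Mapping.single 0 (c i) * Poly_Mapping.single (\<sigma> i) 1)"
    by (rule sum.mono_neutral_left) (use N in \<open>auto simp: c_def\<close>)
  finally show ?thesis unfolding \<sigma>_def by blast
qed

lemma polynomial_nullstellensatz:
  fixes f :: spoly
  assumes "is_ideal J" and "\<And>k. f ^ k \<notin> J"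
  obtains ev :: "spoly \<Rightarrow> complex" where
    "\<And>x y. ev (x + y) = ev x + ev y" "\<And>x y. ev (x * y) = ev x * ev y"
    "\<And>c. ev (Poly_Mapping.single 0 c) = c"
    "\<And>x. x \<in> J \<Longrightarrow> ev x = 0" "ev f \<noteq> 0"
proof (rule countable_dimension_nullstellensatz[of "Poly_Mapping.single 0"
      "\<lambda>i. Poly_Mapping.single (from_nat_into UNIV i) 1" J f, OF _ _ _ _ assms])
qed (use spoly_spanning that in \<open>auto simp: single_add mult_single\<close>)

text \<open>A character of the polynomial ring is evaluation at a point; the order of the indices
reflects the trace pairing.\<close>

lemma sym_eval_eq_character:
  fixes ev :: "spoly \<Rightarrow> complex"
  assumes add: "\<And>x y. ev (x + y) = ev x + ev y" and mult: "\<And>x y. ev (x * y) = ev x * ev y"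
    and scalar: "\<And>c. ev (Poly_Mapping.single 0 c) = c"
  shows "sym_eval (\<lambda>s i j. ev (var (s, j, i))) p = ev p"
proof -
  let ?A = "\<lambda>s i j. ev (var (s, j, i))"
  have zero: "ev 0 = 0" and one: "ev 1 = 1" using scalar[of 0] scalar[of 1] by simp_all
  have sum: "ev (sum h T) = (\<Sum>x\<in>T. ev (h x))" for h :: "(letter \<Rightarrow>\<^sub>0 nat) \<Rightarrow> spoly" and T
    by (induction T rule: infinite_finite_induct) (simp_all add: zero add)
  have tf: "trace_form ?A x = ev (var x)" for x by (cases x) simp
  have pow: "ev (Poly_Mapping.single (Poly_Mapping.single x k) 1) = ev (var x) ^ k" for x k
  proof (induction k)
    case (Suc k)
    have "Poly_Mapping.single (Poly_Mapping.single x (Suc k)) 1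
        = var x * Poly_Mapping.single (Poly_Mapping.single x k) (1::complex)"
      by (simp add: var_def mult_single single_add[symmetric])
    then show ?case using Suc mult by simp
  qed (simp add: one)
  have prod: "ev (Poly_Mapping.single (\<Sum>x\<in>T. Poly_Mapping.single x (h x)) 1) = (\<Prod>x\<in>T. ev (var x) ^ h x)"
    if "finite T" for T and h :: "letter \<Rightarrow> nat"
    using that
  proof induction
    case (insert x T)
    have "Poly_Mapping.single (\<Sum>x\<in>insert x T. Poly_Mapping.single x (h x)) (1::complex)
      = Poly_Mapping.single (Poly_Mapping.single x (h x)) 1
        * Poly_Mapping.single (\<Sum>x\<in>T. Poly_Mapping.single x (h x)) 1"
      using insert(1,2) by (simp add: mult_single)
    then show ?case using insert mult pow by simp
  qed (simp add: one)
  have mon: "ev (Poly_Mapping.single m c)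
      = c * (\<Prod>x\<in>Poly_Mapping.keys m. trace_form ?A x ^ Poly_Mapping.lookup m x)" for m c
  proof -
    have "Poly_Mapping.single m c = Poly_Mapping.single 0 c *
        Poly_Mapping.single (\<Sum>x\<in>Poly_Mapping.keys m. Poly_Mapping.single x (Poly_Mapping.lookup m x)) 1"
      by (simp add: mult_single poly_mapping_sum_single[symmetric])
    then show ?thesis by (simp only: mult scalar prod finite_keys tf)
  qed
  show ?thesis
    unfolding sym_eval_def mon[symmetric] sum[symmetric] poly_mapping_sum_single[symmetric] ..
qed

section \<open>Symbols of annihilating tensors\<close>

lemma homogeneous_image_altdef:
  "homogeneous_image m t = (\<Sum>w\<in>Poly_Mapping.keys t.
     if length w = m then Poly_Mapping.single (word_mon w) (Poly_Mapping.lookup t w) else 0)"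
  unfolding homogeneous_image_def word_mon_def by (rule sum.inter_filter) simp

lemma homogeneous_image_add: "homogeneous_image m (t + t') = homogeneous_image m t + homogeneous_image m t'"
  unfolding homogeneous_image_altdef
  by (rule setsum_keys_plus_distrib) (simp_all add: single_add)

lemma homogeneous_image_zero [simp]: "homogeneous_image m 0 = 0"
  by (simp add: homogeneous_image_def)

lemma homogeneous_image_single:
  "homogeneous_image m (Poly_Mapping.single w c) = (if length w = m then Poly_Mapping.single (word_mon w) c else 0)"
  by (simp add: homogeneous_image_altdef)

lemma homogeneous_image_sum:
  "homogeneous_image m (sum h T) = (\<Sum>x\<in>T. homogeneous_image m (h x))"
  by (induction T rule: infinite_finite_induct) (simp_all add: homogeneous_image_add)

lemma lookup_homogeneous_image:
  "Poly_Mapping.lookup (homogeneous_image m t) e =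
     (\<Sum>w | w \<in> Poly_Mapping.keys t \<and> length w = m \<and> word_mon w = e. Poly_Mapping.lookup t w)"
proof -
  have "Poly_Mapping.lookup (homogeneous_image m t) e =
      (\<Sum>w\<in>Poly_Mapping.keys t. if length w = m \<and> word_mon w = e then Poly_Mapping.lookup t w else 0)"
    unfolding homogeneous_image_altdef lookup_sum by (rule sum.cong) (auto simp: lookup_single when_def)
  then show ?thesis by (simp add: sum.inter_filter)
qed

definition prepend :: "letter list \<Rightarrow> complex \<Rightarrow> tens \<Rightarrow> tens" where
  "prepend a c t = (\<Sum>w\<in>Poly_Mapping.keys t. Poly_Mapping.single (a @ w) (c * Poly_Mapping.lookup t w))"

lemma keys_prepend: "Poly_Mapping.keys (prepend a c t) \<subseteq> (@) a ` Poly_Mapping.keys t"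
  unfolding prepend_def by (rule order.trans[OF keys_sum]) (auto split: if_splits)

lemma homogeneous_image_prepend:
  "homogeneous_image (length a + m) (prepend a c t) = Poly_Mapping.single (word_mon a) c * homogeneous_image m t"
  unfolding prepend_def homogeneous_image_sum homogeneous_image_altdef[of m t] sum_distrib_left
  by (rule sum.cong) (simp_all add: homogeneous_image_single mult_single)

text \<open>Powers of the generic matrix, whose entry \<open>(b, a)\<close> is the letter \<open>(s, a, b)\<close>, in accordance with
the trace pairing.\<close>

primrec var_mpow :: "nat \<Rightarrow> emb \<Rightarrow> nat \<Rightarrow> nat \<Rightarrow> nat \<Rightarrow> spoly" where
  "var_mpow n s 0 b i = (if b = i \<and> i < n then 1 else 0)"
| "var_mpow n s (Suc r) b i = (\<Sum>a<n. var (s, a, b) * var_mpow n s r a i)"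

lemma character_var_mpow:
  fixes ev :: "spoly \<Rightarrow> complex"
  assumes add: "\<And>x y. ev (x + y) = ev x + ev y" and mult: "\<And>x y. ev (x * y) = ev x * ev y"
    and scalar: "\<And>c. ev (Poly_Mapping.single 0 c) = c"
  shows "ev (var_mpow n s r b i) = mpow n (\<lambda>i j. ev (var (s, j, i))) r b i"
proof -
  have zero: "ev 0 = 0" and one: "ev 1 = 1" using scalar[of 0] scalar[of 1] by simp_all
  have sum: "ev (sum h T) = (\<Sum>x\<in>T. ev (h x))" for h :: "nat \<Rightarrow> spoly" and T
    by (induction T rule: infinite_finite_induct) (simp_all add: zero add)
  show ?thesis
    by (induction r arbitrary: b) (simp_all add: mid_def zero one sum mult mmult_def)
qed

lemma mpow_zero_mono:
  assumes "mpow n A d = (\<lambda>i j. 0)"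
  shows "mpow n A (e + d) = (\<lambda>i j. 0)"
  using assms by (induction e) (simp_all add: mmult_def)

lemma depth_nilpotent:
  assumes "depth F n smul \<rho> \<le> enat d" and "A \<in> annihilator_variety F n smul \<rho>" and "s \<in> embs F"
  shows "mpow n (A s) d = (\<lambda>i j. 0)"
proof -
  let ?S = "{enat d | d. \<forall>A\<in>annihilator_variety F n smul \<rho>. \<forall>s\<in>embs F. mpow n (A s) d = (\<lambda>i j. 0)}"
  have "Inf ?S \<le> enat d" using assms(1) unfolding depth_def .
  then have "?S \<noteq> {}" using Inf_enat_def[of ?S] by (intro notI) simp
  then have "Inf ?S \<in> ?S"
    unfolding Inf_enat_def by (metis (mono_tags, lifting) LeastI ex_in_conv)
  then obtain d' where d': "Inf ?S = enat d'" "mpow n (A s) d' = (\<lambda>i j. 0)"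
    using assms(2,3) by auto
  then have "d' \<le> d" using assms(1) unfolding depth_def by simp
  then show ?thesis using mpow_zero_mono[OF d'(2), of "d - d'"] by simp
qed

context gl_module
begin

lemma act_linear_simps:
  assumes "X \<in> gl F n"
  shows "\<rho> X (v + w) = \<rho> X v + \<rho> X w" "\<rho> X (smul c v) = smul c (\<rho> X v)" "\<rho> X 0 = 0"
    "\<rho> X (v - w) = \<rho> X v - \<rho> X w" "\<rho> X (\<Sum>i\<in>T. h i) = (\<Sum>i\<in>T. \<rho> X (h i))"
proof -
  interpret Vector_Spaces.linear smul smul "\<rho> X" using act_linear[OF assms] .
  show "\<rho> X (v + w) = \<rho> X v + \<rho> X w" "\<rho> X (smul c v) = smul c (\<rho> X v)" "\<rho> X 0 = 0"
    "\<rho> X (v - w) = \<rho> X v - \<rho> X w" "\<rho> X (\<Sum>i\<in>T. h i) = (\<Sum>i\<in>T. \<rho> X (h i))"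
    by (simp_all add: add scale zero diff sum)
qed

lemma unit_of_in_gl: "x \<in> letters F n \<Longrightarrow> unit_of x \<in> gl F n"
  by (cases x) (auto simp: letters_def gl_def mats_def fun_eq_iff)

abbreviation word_act :: "letter list \<Rightarrow> 'v \<Rightarrow> 'v" where
  "word_act w \<equiv> foldr (\<lambda>x. \<rho> (unit_of x)) w"

lemma word_act_linear:
  assumes "set w \<subseteq> letters F n"
  shows "word_act w (u + v) = word_act w u + word_act w v" "word_act w (smul c v) = smul c (word_act w v)"
    "word_act w 0 = 0" "word_act w (u - v) = word_act w u - word_act w v"
    "word_act w (\<Sum>i\<in>T. h i) = (\<Sum>i\<in>T. word_act w (h i))"
  using assms by (induction w) (auto simp: act_linear_simps unit_of_in_gl)

lemma tens_act_add: "tens_act smul \<rho> (t + t') v = tens_act smul \<rho> t v + tens_act smul \<rho> t' v"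
  unfolding tens_act_def by (rule setsum_keys_plus_distrib) (simp_all add: scale_left_distrib)

lemma tens_act_zero: "tens_act smul \<rho> 0 v = 0"
  by (simp add: tens_act_def)

lemma tens_act_sum: "tens_act smul \<rho> (sum h T) v = (\<Sum>x\<in>T. tens_act smul \<rho> (h x) v)"
  by (induction T rule: infinite_finite_induct) (simp_all add: tens_act_add tens_act_zero)

lemma tens_act_single: "tens_act smul \<rho> (Poly_Mapping.single w c) v = smul c (word_act w v)"
  by (simp add: tens_act_def)

lemma tens_act_prepend:
  assumes "set a \<subseteq> letters F n"
  shows "tens_act smul \<rho> (prepend a c t) v = smul c (word_act a (tens_act smul \<rho> t v))"
  unfolding prepend_def tens_act_sum tens_act_single
  by (simp add: tens_act_def word_act_linear[OF assms] scale_sum_right)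

definition annihilating :: "nat \<Rightarrow> tens set" where
  "annihilating m = {t \<in> tensor_algebra F n. (\<forall>w\<in>Poly_Mapping.keys t. length w \<le> m) \<and>
     (\<forall>v. tens_act smul \<rho> t v = 0)}"

text \<open>The polynomials all of whose homogeneous components in the letters of \<open>gl F n\<close> are leading terms
of annihilating tensors. The condition on \<open>p\<close> concerns only monomials in these
letters, so that the variables outside of \<open>gl F n\<close> belong to the ideal.\<close>

definition symbol_ideal :: "spoly set" where
  "symbol_ideal = {p. \<forall>m. \<exists>t\<in>annihilating m. \<forall>w. set w \<subseteq> letters F n \<longrightarrow> length w = m \<longrightarrow>
     Poly_Mapping.lookup p (word_mon w) = Poly_Mapping.lookup (homogeneous_image m t) (word_mon w)}"

lemma zero_annihilating: "0 \<in> annihilating m"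
  by (simp add: annihilating_def tensor_algebra_def tens_act_zero)

lemma add_annihilating: "t \<in> annihilating m \<Longrightarrow> t' \<in> annihilating m \<Longrightarrow> t + t' \<in> annihilating m"
  using keys_add[of t t'] by (auto simp: annihilating_def tensor_algebra_def tens_act_add)

lemma prepend_annihilating:
  "set a \<subseteq> letters F n \<Longrightarrow> t \<in> annihilating m \<Longrightarrow> prepend a c t \<in> annihilating (length a + m)"
  using keys_prepend[of a c t]
  by (fastforce simp: annihilating_def tensor_algebra_def tens_act_prepend word_act_linear)

lemma symbol_ideal_add:
  assumes "p \<in> symbol_ideal" "p' \<in> symbol_ideal"
  shows "p + p' \<in> symbol_ideal"
  unfolding symbol_ideal_def
proof (intro CollectI allI)
  fix m
  obtain t where t: "t \<in> annihilating m" "\<And>w. set w \<subseteq> letters F n \<Longrightarrow> length w = m \<Longrightarrow>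
       Poly_Mapping.lookup p (word_mon w) = Poly_Mapping.lookup (homogeneous_image m t) (word_mon w)"
    using assms(1) unfolding symbol_ideal_def by blast
  obtain t' where t': "t' \<in> annihilating m" "\<And>w. set w \<subseteq> letters F n \<Longrightarrow> length w = m \<Longrightarrow>
       Poly_Mapping.lookup p' (word_mon w) = Poly_Mapping.lookup (homogeneous_image m t') (word_mon w)"
    using assms(2) unfolding symbol_ideal_def by blast
  show "\<exists>t\<in>annihilating m. \<forall>w. set w \<subseteq> letters F n \<longrightarrow> length w = m \<longrightarrow>
     Poly_Mapping.lookup (p + p') (word_mon w) = Poly_Mapping.lookup (homogeneous_image m t) (word_mon w)"
    by (intro bexI[of _ "t + t'"] allI impI)
      (simp_all add: homogeneous_image_add lookup_add t(2) t'(2) add_annihilating t(1) t'(1))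
qed

lemma symbol_ideal_zeroI:
  assumes "\<And>w. set w \<subseteq> letters F n \<Longrightarrow> Poly_Mapping.lookup p (word_mon w) = 0"
  shows "p \<in> symbol_ideal"
  unfolding symbol_ideal_def using assms zero_annihilating by (auto intro!: bexI[of _ 0])

text \<open>If \<open>t\<close> annihilates the module, then so does every word times \<open>t\<close>, and its leading term is the
monomial of the word times that of \<open>t\<close>.\<close>

lemma symbol_ideal_monomial_mult:
  assumes p: "p \<in> symbol_ideal"
  shows "Poly_Mapping.single e c * p \<in> symbol_ideal"
proof -
  obtain a where e: "e = word_mon a" using word_mon_surj by blast
  show ?thesis
  proof (cases "set a \<subseteq> letters F n")
    case False
    have "word_mon w \<noteq> word_mon a + e'" if "set w \<subseteq> letters F n" for w e'
      using False that by (metis word_mon_diff Un_subset_iff mset_eq_setD set_append)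
    then show ?thesis unfolding e by (intro symbol_ideal_zeroI lookup_single_mult(2))
  next
    case a: True
    show ?thesis unfolding symbol_ideal_def
    proof (intro CollectI allI)
      fix m
      let ?P = "\<lambda>t. \<forall>w. set w \<subseteq> letters F n \<longrightarrow> length w = m \<longrightarrow>
        Poly_Mapping.lookup (Poly_Mapping.single e c * p) (word_mon w) =
        Poly_Mapping.lookup (homogeneous_image m t) (word_mon w)"
      show "\<exists>t\<in>annihilating m. ?P t"
      proof (cases "length a \<le> m")
        case False
        have "word_mon w \<noteq> word_mon a + e'" if "length w = m" for w e'
          using False that by (metis word_mon_diff le_add1 length_append size_mset)
        then have "?P 0" unfolding e by (auto intro: lookup_single_mult(2))
        then show ?thesis using zero_annihilating by blast
      next
        case True
        then obtain m' where m: "m = length a + m'" using le_Suc_ex by blast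
        obtain t where t: "t \<in> annihilating m'" and tp: "\<And>w. set w \<subseteq> letters F n \<Longrightarrow> length w = m' \<Longrightarrow>
           Poly_Mapping.lookup p (word_mon w) = Poly_Mapping.lookup (homogeneous_image m' t) (word_mon w)"
          using p unfolding symbol_ideal_def by blast
        have "?P (prepend a c t)"
        proof (intro allI impI)
          fix w assume w: "set w \<subseteq> letters F n" "length w = m"
          show "Poly_Mapping.lookup (Poly_Mapping.single e c * p) (word_mon w) =
            Poly_Mapping.lookup (homogeneous_image m (prepend a c t)) (word_mon w)"
          proof (cases "\<exists>e'. word_mon w = word_mon a + e'")
            case True
            then obtain b where b: "mset w = mset (a @ b)" by (metis word_mon_diff)
            then have b': "word_mon w = word_mon a + word_mon b" by (metis word_mon_append word_mon_eq_iff)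
            have "set b \<subseteq> letters F n" using b w(1) by (metis Un_subset_iff mset_eq_setD set_append)
            moreover have "length b = m'"
              using b w(2) m by (metis add_left_cancel length_append size_mset)
            ultimately show ?thesis
              unfolding m homogeneous_image_prepend e b' lookup_single_mult(1) using tp by simp
          next
            case False
            then show ?thesis
              unfolding m homogeneous_image_prepend e by (simp add: lookup_single_mult(2))
          qed
        qed
        then show ?thesis using prepend_annihilating[OF a t] m by blast
      qed
    qed
  qed
qed

lemma is_ideal_symbol_ideal: "is_ideal symbol_ideal"
  unfolding is_ideal_def
proof (intro conjI ballI allI)
  show zero: "0 \<in> symbol_ideal" by (rule symbol_ideal_zeroI) simp
  show "p + p' \<in> symbol_ideal" if "p \<in> symbol_ideal" "p' \<in> symbol_ideal" for p p'
    using symbol_ideal_add that .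
  show "r * p \<in> symbol_ideal" if p: "p \<in> symbol_ideal" for p r
  proof -
    have "(\<Sum>e\<in>T. Poly_Mapping.single e (Poly_Mapping.lookup r e) * p) \<in> symbol_ideal" for T
      by (induction T rule: infinite_finite_induct)
        (simp_all add: zero symbol_ideal_add symbol_ideal_monomial_mult p)
    from this[of "Poly_Mapping.keys r"] show ?thesis
      unfolding sum_distrib_right[symmetric] poly_mapping_sum_single[symmetric] .
  qed
qed

lemma symbols_subset_symbol_ideal:
  assumes u: "u \<in> annihilator F n smul \<rho>"
  shows "symbols F n u \<subseteq> symbol_ideal"
proof
  fix p assume "p \<in> symbols F n u"
  then obtain m t where p: "p = homogeneous_image m t" and t: "t \<in> u" "\<forall>w\<in>Poly_Mapping.keys t. length w \<le> m"
    unfolding symbols_def by blast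
  have "t \<in> tensor_algebra F n" using u t(1) by (auto simp: annihilator_def enveloping_def u_class_def)
  then have ann: "t \<in> annihilating m" using u t by (auto simp: annihilating_def annihilator_def)
  show "p \<in> symbol_ideal"
    unfolding symbol_ideal_def
  proof (intro CollectI allI)
    fix m'
    have "Poly_Mapping.lookup p (word_mon w) = 0" if "length w \<noteq> m" for w
      unfolding p lookup_homogeneous_image using that by (auto simp: word_mon_eq_iff dest: mset_eq_length intro!: sum.neutral)
    then show "\<exists>t\<in>annihilating m'. \<forall>w. set w \<subseteq> letters F n \<longrightarrow> length w = m' \<longrightarrow>
        Poly_Mapping.lookup p (word_mon w) = Poly_Mapping.lookup (homogeneous_image m' t) (word_mon w)"
      using ann p zero_annihilating by (cases "m' = m") (auto intro: bexI[of _ 0])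
  qed
qed

lemma sym_ideal_subset_symbol_ideal:
  "sym_ideal F n (\<Union>u\<in>annihilator F n smul \<rho>. symbols F n u) \<subseteq> symbol_ideal"
proof
  note I = is_idealD[OF is_ideal_symbol_ideal]
  fix p assume "p \<in> sym_ideal F n (\<Union>u\<in>annihilator F n smul \<rho>. symbols F n u)"
  then obtain Q c where p: "p = (\<Sum>q\<in>Q. c q * q)"
    and Q: "Q \<subseteq> (\<Union>u\<in>annihilator F n smul \<rho>. symbols F n u)"
    unfolding sym_ideal_def by blast
  have "Q \<subseteq> symbol_ideal" using Q symbols_subset_symbol_ideal by blast
  then show "p \<in> symbol_ideal" unfolding p by (intro I(5) I(3)) blast
qed

text \<open>A character that vanishes on \<open>symbol_ideal\<close> but not on the entry of the generic power would be a
point \<open>A\<close> of the annihilator variety with \<open>A\<^sup>d \<noteq> 0\<close>, against the depth condition.\<close>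

lemma var_mpow_power_in_symbol_ideal:
  assumes depth: "depth F n smul \<rho> \<le> enat d" and s: "s \<in> embs F"
  shows "\<exists>k. var_mpow n s d b i ^ k \<in> symbol_ideal"
proof (rule ccontr)
  assume no: "\<nexists>k. var_mpow n s d b i ^ k \<in> symbol_ideal"
  show False
  proof (rule polynomial_nullstellensatz[OF is_ideal_symbol_ideal])
    show "var_mpow n s d b i ^ k \<notin> symbol_ideal" for k using no by blast
  next
    fix ev :: "spoly \<Rightarrow> complex"
    assume ev: "\<And>x y. ev (x + y) = ev x + ev y" "\<And>x y. ev (x * y) = ev x * ev y"
      "\<And>c. ev (Poly_Mapping.single 0 c) = c"
    assume evJ: "\<And>x. x \<in> symbol_ideal \<Longrightarrow> ev x = 0" and evf: "ev (var_mpow n s d b i) \<noteq> 0"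
    define A where "A = (\<lambda>s i j. ev (var (s, j, i)))"
    have "ev (var x) = 0" if "x \<notin> letters F n" for x
    proof (rule evJ, rule symbol_ideal_zeroI)
      fix w assume "set w \<subseteq> letters F n"
      then have "word_mon w \<noteq> word_mon [x]" using that by (auto simp: word_mon_eq_iff simp del: word_mon_Cons)
      then show "Poly_Mapping.lookup (var x) (word_mon w) = 0"
        by (auto simp: var_def lookup_single when_def)
    qed
    then have "A \<in> gl F n"
      unfolding A_def gl_def mats_def letters_def by (auto simp: fun_eq_iff)
    moreover have "sym_eval A p = 0" if "p \<in> symbol_ideal" for p
      unfolding A_def using sym_eval_eq_character[OF ev] evJ[OF that] by simp
    ultimately have "A \<in> annihilator_variety F n smul \<rho>"
      using sym_ideal_subset_symbol_ideal unfolding annihilator_variety_def by blast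
    then have "mpow n (A s) d = (\<lambda>i j. 0)" using depth_nilpotent[OF depth _ s] by blast
    then have "ev (var_mpow n s d b i) = 0" unfolding character_var_mpow[OF ev] A_def by simp
    then show False using evf by simp
  qed
qed

end

section \<open>Bad monomials in the entries of a matrix power\<close>

fun block_weight :: "nat \<Rightarrow> letter \<Rightarrow> int" where
  "block_weight p (s, i, j) = of_bool (i < p) - of_bool (j < p)"

text \<open>The standard degree 1 minus the weight under the diagonal matrix that has entry
\<open>- (i - p)\<close>, with truncated subtraction, in row \<open>i\<close>.\<close>

fun kazhdan_degree :: "nat \<Rightarrow> letter \<Rightarrow> int" where
  "kazhdan_degree p (s, i, j) = 1 + int (i - p) - int (j - p)"

text \<open>The letters that can contribute to the evaluation of a leading term: the column under
consideration, and the letters where the character of the later columns does not vanish.\<close>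

fun good_letter :: "nat \<Rightarrow> letter \<Rightarrow> bool" where
  "good_letter p (s, i, j) \<longleftrightarrow> j = p \<and> i < p \<or> p < j \<and> j = Suc i"

definition wdeg :: "(letter \<Rightarrow> int) \<Rightarrow> letter list \<Rightarrow> int" where
  "wdeg h w = sum_list (map h w)"

lemma wdeg_simps [simp]: "wdeg h [] = 0" "wdeg h (x # w) = h x + wdeg h w"
    "wdeg h (v @ w) = wdeg h v + wdeg h w"
  by (simp_all add: wdeg_def)

lemma wdeg_mset: "mset w = mset w' \<Longrightarrow> wdeg h w = wdeg h w'"
  unfolding wdeg_def by (metis mset_map sum_mset_sum_list)

lemma power_diff_in_ideal:
  assumes "is_ideal J" "f - g \<in> J"
  shows "f ^ k - g ^ k \<in> J"
proof (induction k)
  case 0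
  show ?case using ideal_zero[OF assms(1)] by simp
next
  case (Suc k)
  have "f ^ Suc k - g ^ Suc k = f * (f ^ k - g ^ k) + g ^ k * (f - g)" by (simp add: algebra_simps)
  then show ?case using is_idealD[OF assms(1)] Suc assms(2) by simp
qed

text \<open>Congruence modulo this monomial ideal discards the paths that do not survive in the quotient.\<close>

definition bad_ideal :: "nat \<Rightarrow> spoly set" where
  "bad_ideal p = {f. \<forall>e\<in>Poly_Mapping.keys f. \<exists>x\<in>Poly_Mapping.keys e. \<not> good_letter p x}"

lemma is_ideal_bad_ideal: "is_ideal (bad_ideal p)"
  unfolding is_ideal_def
proof (intro conjI ballI allI)
  show "0 \<in> bad_ideal p" by (simp add: bad_ideal_def)
next
  fix f g assume "f \<in> bad_ideal p" "g \<in> bad_ideal p"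
  then show "f + g \<in> bad_ideal p" using keys_add[of f g] by (fastforce simp: bad_ideal_def)
next
  fix f r assume f: "f \<in> bad_ideal p"
  show "r * f \<in> bad_ideal p"
    unfolding bad_ideal_def
  proof (intro CollectI ballI)
    fix e assume "e \<in> Poly_Mapping.keys (r * f)"
    then obtain a b where e: "e = a + b" and b: "b \<in> Poly_Mapping.keys f" using keys_mult[of r f] by blast
    obtain x where x: "x \<in> Poly_Mapping.keys b" "\<not> good_letter p x" using f b unfolding bad_ideal_def by blast
    have "x \<in> Poly_Mapping.keys e" using x(1) unfolding e in_keys_iff lookup_add by simp
    then show "\<exists>x\<in>Poly_Mapping.keys e. \<not> good_letter p x" using x(2) by blast
  qed
qed

lemma var_mult_in_bad_ideal:
  assumes "\<not> good_letter p x"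
  shows "var x * f \<in> bad_ideal p"
proof -
  have "var x \<in> bad_ideal p" using assms by (auto simp: bad_ideal_def var_def split: if_splits)
  then show ?thesis using ideal_mult[OF is_ideal_bad_ideal, of "var x" p f] by (simp add: mult.commute)
qed

text \<open>The path \<open>p, p + 1, ..., p + r\<close>. The last step comes first, as in the expansion of a matrix
power along its rows.\<close>

definition steps :: "emb \<Rightarrow> nat \<Rightarrow> nat \<Rightarrow> letter list" where
  "steps s p r = map (\<lambda>j. (s, p + j, Suc (p + j))) (rev [0..<r])"

lemma steps_simps: "steps s p 0 = []" "steps s p (Suc r) = (s, p + r, Suc (p + r)) # steps s p r"
  by (simp_all add: steps_def)

lemma single_word_mon_Cons: "Poly_Mapping.single (word_mon (x # w)) 1 = var x * Poly_Mapping.single (word_mon w) (1::complex)"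
  by (simp add: var_def mult_single)

text \<open>Expand the generic power along its last row. A good letter in column \<open>p + r + 1\<close> must be in row
\<open>p + r\<close>, so only one path remains, step by step.\<close>

lemma var_mpow_mod_bad_ideal:
  assumes "p + r < n" "i < p"
  shows "var_mpow n s (Suc r) (p + r) i - Poly_Mapping.single (word_mon (steps s p r @ [(s, i, p)])) 1 \<in> bad_ideal p"
  using assms(1)
proof (induction r)
  case 0
  have "var_mpow n s (Suc 0) p i = (\<Sum>a<n. if a = i then var (s, i, p) else 0)"
    unfolding var_mpow.simps by (rule sum.cong) (use 0 assms(2) in auto)
  then have "var_mpow n s (Suc 0) p i = var (s, i, p)" using 0 assms(2) by simp
  then show ?case using ideal_zero[OF is_ideal_bad_ideal] by (simp add: steps_simps var_def)
next
  case (Suc r)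
  let ?t = "\<lambda>a. var (s, a, p + Suc r) * var_mpow n s (Suc r) a i"
  let ?m = "Poly_Mapping.single (word_mon (steps s p r @ [(s, i, p)])) (1::complex)"
  note I = is_idealD[OF is_ideal_bad_ideal]
  have "var_mpow n s (Suc (Suc r)) (p + Suc r) i = sum ?t {..<n}" by (rule var_mpow.simps(2))
  also have "\<dots> = ?t (p + r) + sum ?t ({..<n} - {p + r})"
    using Suc.prems by (intro sum.remove) auto
  finally have "var_mpow n s (Suc (Suc r)) (p + Suc r) i - Poly_Mapping.single (word_mon (steps s p (Suc r) @ [(s, i, p)])) 1
      = var (s, p + r, p + Suc r) * (var_mpow n s (Suc r) (p + r) i - ?m) + sum ?t ({..<n} - {p + r})"
    unfolding steps_simps append_Cons single_word_mon_Cons by (simp add: algebra_simps)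
  moreover have "sum ?t ({..<n} - {p + r}) \<in> bad_ideal p"
    by (intro I(5) var_mult_in_bad_ideal) auto
  ultimately show ?case using I(2,3) Suc by simp
qed

section \<open>Commutators and torus weights\<close>

text \<open>The matrix units are kept folded, because words act through the letters as such.\<close>

declare unit_of.simps [simp del]

lemma gl_iff: "X \<in> gl F n \<longleftrightarrow> (\<forall>s i j. X s i j \<noteq> 0 \<longrightarrow> s \<in> embs F \<and> i < n \<and> j < n)"
proof
  assume "X \<in> gl F n"
  then show "\<forall>s i j. X s i j \<noteq> 0 \<longrightarrow> s \<in> embs F \<and> i < n \<and> j < n"
    unfolding gl_def mats_def mem_Collect_eq by metis
next
  assume *: "\<forall>s i j. X s i j \<noteq> 0 \<longrightarrow> s \<in> embs F \<and> i < n \<and> j < n"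
  then show "X \<in> gl F n"
    unfolding gl_def mats_def mem_Collect_eq fun_eq_iff by metis
qed

context gl_module
begin

lemma unit_of_mmult:
  assumes "(s, i, j) \<in> letters F n" "(s', k, l) \<in> letters F n"
  shows "mmult n (unit_of (s, i, j) r) (unit_of (s', k, l) r) a b =
    (if r = s \<and> s = s' \<and> j = k \<and> a = i \<and> b = l then 1 else 0)"
proof -
  have "j < n" using assms by (auto simp: letters_def)
  have "mmult n (unit_of (s, i, j) r) (unit_of (s', k, l) r) a b =
      (\<Sum>c<n. if c = j then (if r = s \<and> s = s' \<and> j = k \<and> a = i \<and> b = l then 1 else 0) else 0)"
    unfolding mmult_def by (rule sum.cong) (auto simp: unit_of.simps)
  then show ?thesis using \<open>j < n\<close> by simp
qed

lemma act_zero: "\<rho> (\<lambda>s i j. 0) v = 0"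
proof -
  have "(\<lambda>s i j. 0) \<in> gl F n" by (simp add: gl_def mats_def)
  from act_scale[OF this, of 0 v] show ?thesis by (simp add: gscale_def)
qed

lemma gl_closed:
  "X \<in> gl F n \<Longrightarrow> Y \<in> gl F n \<Longrightarrow> gadd X Y \<in> gl F n" "X \<in> gl F n \<Longrightarrow> gscale c X \<in> gl F n"
proof -
  show "gadd X Y \<in> gl F n" if "X \<in> gl F n" "Y \<in> gl F n"
    unfolding gl_iff
  proof (intro allI impI)
    fix s i j assume "gadd X Y s i j \<noteq> 0"
    then have "X s i j \<noteq> 0 \<or> Y s i j \<noteq> 0" by (auto simp: gadd_def)
    then show "s \<in> embs F \<and> i < n \<and> j < n" using that unfolding gl_iff by blast
  qed
  show "X \<in> gl F n \<Longrightarrow> gscale c X \<in> gl F n"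
    unfolding gl_iff gscale_def by auto
qed

lemma unit_commutator:
  assumes x: "(s, i, j) \<in> letters F n" and y: "(s', k, l) \<in> letters F n"
  shows "\<rho> (unit_of (s, i, j)) (\<rho> (unit_of (s', k, l)) v) = \<rho> (unit_of (s', k, l)) (\<rho> (unit_of (s, i, j)) v)
    + (if s = s' \<and> j = k then \<rho> (unit_of (s, i, l)) v else 0)
    - (if s = s' \<and> l = i then \<rho> (unit_of (s, k, j)) v else 0)"
proof -
  let ?U = "if s = s' \<and> j = k then unit_of (s, i, l) else (\<lambda>s i j. 0)"
  let ?V = "if s = s' \<and> l = i then unit_of (s, k, j) else (\<lambda>s i j. 0)"
  have "gbracket n (unit_of (s, i, j)) (unit_of (s', k, l)) = gadd ?U (gscale (- 1) ?V)"
    unfolding gbracket_def unit_of_mmult[OF x y] unit_of_mmult[OF y x]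
    by (auto simp: gadd_def gscale_def fun_eq_iff unit_of.simps)
  moreover have UV: "?U \<in> gl F n" "?V \<in> gl F n"
    using x y unit_of_in_gl[of "(s, i, l)"] unit_of_in_gl[of "(s, k, j)"]
    by (auto simp: letters_def gl_def mats_def)
  ultimately have "\<rho> (gbracket n (unit_of (s, i, j)) (unit_of (s', k, l))) v = \<rho> ?U v - \<rho> ?V v"
    using act_add[OF UV(1) gl_closed(2)[OF UV(2)], of "- 1" v] act_scale[OF UV(2), of "- 1" v] by simp
  moreover have "\<rho> ?U v = (if s = s' \<and> j = k then \<rho> (unit_of (s, i, l)) v else 0)"
    "\<rho> ?V v = (if s = s' \<and> l = i then \<rho> (unit_of (s, k, j)) v else 0)"
    by (simp_all add: act_zero)
  ultimately show ?thesis
    using act_bracket[OF unit_of_in_gl[OF x] unit_of_in_gl[OF y], of v] by (simp add: algebra_simps)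
qed

lemma diagonal_commutator:
  fixes \<eta> :: "nat \<Rightarrow> complex"
  defines "H \<equiv> (\<lambda>s i j. if s \<in> embs F \<and> i = j \<and> i < n then \<eta> i else 0) :: glie"
  assumes w: "set w \<subseteq> letters F n"
  shows "\<rho> H (word_act w v) = word_act w (\<rho> H v)
    + smul (sum_list (map (\<lambda>(s, i, j). \<eta> i - \<eta> j) w)) (word_act w v)"
  using w
proof (induction w)
  case (Cons x w)
  obtain s i j where x: "x = (s, i, j)" by (cases x)
  have H: "H \<in> gl F n" by (auto simp: H_def gl_def mats_def fun_eq_iff)
  have xl: "x \<in> letters F n" and sij: "s \<in> embs F" "i < n" "j < n" using Cons.prems x by (auto simp: letters_def)
  have "gbracket n H (unit_of x) = gscale (\<eta> i - \<eta> j) (unit_of x)"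
  proof (intro ext)
    fix r a b
    have "mmult n (H r) (unit_of x r) a b = (\<Sum>c<n. if c = i then (if r = s \<and> a = i \<and> b = j then \<eta> i else 0) else 0)"
      unfolding mmult_def by (rule sum.cong) (use sij in \<open>auto simp: H_def x unit_of.simps\<close>)
    moreover have "mmult n (unit_of x r) (H r) a b = (\<Sum>c<n. if c = j then (if r = s \<and> a = i \<and> b = j then \<eta> j else 0) else 0)"
      unfolding mmult_def by (rule sum.cong) (use sij in \<open>auto simp: H_def x unit_of.simps\<close>)
    ultimately show "gbracket n H (unit_of x) r a b = gscale (\<eta> i - \<eta> j) (unit_of x) r a b"
      unfolding gbracket_def gscale_def using sij by (simp add: x unit_of.simps)
  qed
  then have "smul (\<eta> i - \<eta> j) (\<rho> (unit_of x) u) = \<rho> H (\<rho> (unit_of x) u) - \<rho> (unit_of x) (\<rho> H u)" for u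
    using act_bracket[OF H unit_of_in_gl[OF xl], of u] act_scale[OF unit_of_in_gl[OF xl], of "\<eta> i - \<eta> j" u] by simp
  then have *: "\<rho> H (\<rho> (unit_of x) u) = \<rho> (unit_of x) (\<rho> H u) + smul (\<eta> i - \<eta> j) (\<rho> (unit_of x) u)" for u
    by (simp add: algebra_simps)
  show ?case
    using Cons * by (simp add: x[symmetric] act_linear_simps[OF unit_of_in_gl[OF xl]] scale_left_distrib add_ac)
      (simp add: x)
qed simp

text \<open>Commuting with a diagonal matrix multiplies each word by its weight. So a relation
between words remains one when the coefficients are multiplied by a polynomial in the weight,
and a suitable polynomial singles out one weight.\<close>

lemma weight_component_annihilates:
  fixes \<eta> :: "nat \<Rightarrow> complex" and c :: "letter list \<Rightarrow> complex"
  defines "wt \<equiv> \<lambda>w. sum_list (map (\<lambda>(s, i, j). \<eta> i - \<eta> j) w)"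
  assumes W: "finite W" "\<And>w. w \<in> W \<Longrightarrow> set w \<subseteq> letters F n"
    and zero: "\<And>v. (\<Sum>w\<in>W. smul (c w) (word_act w v)) = 0"
  shows "(\<Sum>w | w \<in> W \<and> wt w = \<nu>. smul (c w) (word_act w v)) = 0"
proof -
  define H :: glie where "H = (\<lambda>s i j. if s \<in> embs F \<and> i = j \<and> i < n then \<eta> i else 0)"
  have H: "H \<in> gl F n" by (auto simp: H_def gl_def mats_def fun_eq_iff)
  \<comment> \<open>Take the commutator of the relation with \<open>H\<close>.\<close>
  have shift: "(\<Sum>w\<in>W. smul (a w * (wt w - \<mu>)) (word_act w v)) = 0"
    if a: "\<And>v. (\<Sum>w\<in>W. smul (a w) (word_act w v)) = 0" for a \<mu> v
  proof -
    have "\<rho> H (word_act w v) = word_act w (\<rho> H v) + smul (wt w) (word_act w v)" if "w \<in> W" for w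
      unfolding H_def wt_def using diagonal_commutator W(2)[OF that] by blast
    then have "(\<Sum>w\<in>W. smul (a w * (wt w - \<mu>)) (word_act w v))
      = (\<Sum>w\<in>W. \<rho> H (smul (a w) (word_act w v)) - smul (a w) (word_act w (\<rho> H v))
          - smul \<mu> (smul (a w) (word_act w v)))"
      by (intro sum.cong) (simp_all add: act_linear_simps[OF H] algebra_simps)
    also have "\<dots> = \<rho> H (\<Sum>w\<in>W. smul (a w) (word_act w v)) - (\<Sum>w\<in>W. smul (a w) (word_act w (\<rho> H v)))
          - smul \<mu> (\<Sum>w\<in>W. smul (a w) (word_act w v))"
      by (simp add: sum_subtractf act_linear_simps[OF H] scale_sum_right)
    also have "\<dots> = 0" unfolding a by (simp add: act_linear_simps[OF H])
    finally show ?thesis .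
  qed
  have many: "(\<Sum>w\<in>W. smul (c w * (\<Prod>\<mu>\<in>T. wt w - \<mu>)) (word_act w v)) = 0" if "finite T" for T v
    using that
  proof (induction T arbitrary: v)
    case empty
    then show ?case using zero by simp
  next
    case (insert \<mu> T)
    have "(\<Sum>w\<in>W. smul ((c w * (\<Prod>\<mu>\<in>T. wt w - \<mu>)) * (wt w - \<mu>)) (word_act w v)) = 0"
      by (rule shift) (rule insert.IH)
    then show ?case using insert.hyps by (simp add: mult_ac)
  qed
  define T where "T = wt ` W - {\<nu>}"
  define K where "K = (\<Prod>\<mu>\<in>T. \<nu> - \<mu>)"
  have T: "finite T" using W(1) by (simp add: T_def)
  have K: "K \<noteq> 0" unfolding K_def using T by (auto simp: T_def)
  have "0 = (\<Sum>w\<in>W. smul (c w * (\<Prod>\<mu>\<in>T. wt w - \<mu>)) (word_act w v))" using many[OF T] by simp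
  also have "\<dots> = (\<Sum>w | w \<in> W \<and> wt w = \<nu>. smul K (smul (c w) (word_act w v)))"
  proof (rule sum.mono_neutral_cong_right)
    show "\<forall>w\<in>W - {w \<in> W. wt w = \<nu>}. smul (c w * (\<Prod>\<mu>\<in>T. wt w - \<mu>)) (word_act w v) = 0"
    proof
      fix w assume "w \<in> W - {w \<in> W. wt w = \<nu>}"
      then have "wt w \<in> T" by (auto simp: T_def)
      then have "(\<Prod>\<mu>\<in>T. wt w - \<mu>) = 0" using T by auto
      then show "smul (c w * (\<Prod>\<mu>\<in>T. wt w - \<mu>)) (word_act w v) = 0" by simp
    qed
  qed (use W(1) in \<open>auto simp: K_def mult_ac\<close>)
  also have "\<dots> = smul K (\<Sum>w | w \<in> W \<and> wt w = \<nu>. smul (c w) (word_act w v))"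
    by (simp add: scale_sum_right)
  finally show ?thesis using K by simp
qed

end

section \<open>Words modulo a character of the upper triangular columns\<close>

text \<open>The projection to an iterated derivative, reduced to what reordering words requires.\<close>

locale whittaker_quotient = gl_module F n smul \<rho>
  for F :: base_field and n :: nat
    and smul :: "complex \<Rightarrow> 'v::ab_group_add \<Rightarrow> 'v"
    and \<rho> :: "glie \<Rightarrow> 'v \<Rightarrow> 'v" +
  fixes p :: nat and \<kappa> :: complex and q :: "'v \<Rightarrow> 'v"
  assumes q_linear: "Vector_Spaces.linear smul smul q"
    and \<kappa>: "\<kappa> \<noteq> 0"
    and p: "p < n"
    and q_upper: "\<lbrakk>(s, i, j) \<in> letters F n; i < j; p < j\<rbrakk> \<Longrightarrow>
      q (\<rho> (unit_of (s, i, j)) v) = smul (if j = Suc i then \<kappa> else 0) (q v)"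

context whittaker_quotient
begin

lemma q_simps:
  "q (v + w) = q v + q w" "q (smul c v) = smul c (q v)" "q 0 = 0" "q (v - w) = q v - q w"
  "q (\<Sum>i\<in>T. h i) = (\<Sum>i\<in>T. q (h i))"
proof -
  interpret Vector_Spaces.linear smul smul q by (rule q_linear)
  show "q (v + w) = q v + q w" "q (smul c v) = smul c (q v)" "q 0 = 0" "q (v - w) = q v - q w"
    "q (\<Sum>i\<in>T. h i) = (\<Sum>i\<in>T. q (h i))"
    by (simp_all add: add scale zero diff sum)
qed

abbreviation "\<beta> \<equiv> wdeg (block_weight p)"
abbreviation "\<delta> \<equiv> wdeg (kazhdan_degree p)"

text \<open>The induction hypothesis in the proof that words with \<open>\<delta> < \<beta>\<close> are killed. It is
what is needed to reorder the letters of words of length \<open>N\<close> with \<open>\<delta> \<le> \<beta>\<close>, since the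
commutators are shorter and have smaller \<open>\<delta>\<close>.\<close>

definition kills_low :: "nat \<Rightarrow> bool" where
  "kills_low N \<longleftrightarrow> (\<forall>w v. length w < N \<longrightarrow> set w \<subseteq> letters F n \<longrightarrow> \<delta> w < \<beta> w \<longrightarrow> q (word_act w v) = 0)"

lemma swap_letters:
  assumes low: "kills_low (length (c @ y # x # b))" and l: "set (c @ y # x # b) \<subseteq> letters F n"
    and d: "\<delta> (c @ y # x # b) \<le> \<beta> (c @ y # x # b)"
  shows "q (word_act (c @ y # x # b) v) = q (word_act (c @ x # y # b) v)"
proof -
  obtain s i j where y: "y = (s, i, j)" by (cases y)
  obtain s' k m where x: "x = (s', k, m)" by (cases x)
  have lc: "set c \<subseteq> letters F n" "set b \<subseteq> letters F n" and ll: "(s, i, j) \<in> letters F n" "(s', k, m) \<in> letters F n"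
    using l x y by auto
  have lt: "q (word_act c (\<rho> (unit_of z) (word_act b v))) = 0"
    if z: "z \<in> letters F n" "kazhdan_degree p z = kazhdan_degree p x + kazhdan_degree p y - 1"
      "block_weight p z = block_weight p x + block_weight p y" for z
  proof -
    have "length (c @ z # b) < length (c @ y # x # b)" "set (c @ z # b) \<subseteq> letters F n"
      "\<delta> (c @ z # b) < \<beta> (c @ z # b)"
      using lc z d by simp_all
    then have "q (word_act (c @ z # b) v) = 0"
      using low unfolding kills_low_def by blast
    then show ?thesis by simp
  qed
  have 1: "q (word_act c (if s = s' \<and> j = k then \<rho> (unit_of (s, i, m)) (word_act b v) else 0)) = 0"
    using ll x y by (auto simp: word_act_linear[OF lc(1)] q_simps letters_def intro!: lt)
  have 2: "q (word_act c (if s = s' \<and> m = i then \<rho> (unit_of (s, k, j)) (word_act b v) else 0)) = 0"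
    using ll x y by (auto simp: word_act_linear[OF lc(1)] q_simps letters_def intro!: lt)
  show ?thesis
    using 1 2 unit_commutator[OF ll, of "word_act b v"]
    by (simp only: x y foldr_append foldr_Cons comp_apply word_act_linear[OF lc(1)] q_simps) simp
qed

lemma move_letter_front:
  assumes "kills_low (length (c @ a @ x # b))" "set (c @ a @ x # b) \<subseteq> letters F n"
    "\<delta> (c @ a @ x # b) \<le> \<beta> (c @ a @ x # b)"
  shows "q (word_act (c @ a @ x # b) v) = q (word_act (c @ x # a @ b) v)"
  using assms
proof (induction a arbitrary: c)
  case (Cons y a)
  have "q (word_act ((c @ [y]) @ a @ x # b) v) = q (word_act ((c @ [y]) @ x # a @ b) v)"
    using Cons.prems by (intro Cons.IH) simp_all
  also have "\<dots> = q (word_act (c @ y # x # a @ b) v)" by simp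
  also have "\<dots> = q (word_act (c @ x # y # a @ b) v)"
    using Cons.prems by (intro swap_letters) (simp_all add: algebra_simps)
  finally show ?case by simp
qed simp

fun upper_letter :: "letter \<Rightarrow> bool" where
  "upper_letter (s, i, j) \<longleftrightarrow> i < j \<and> p < j"

lemma non_upper_degree:
  "\<not> upper_letter x \<Longrightarrow> block_weight p x \<le> kazhdan_degree p x"
  "\<not> upper_letter x \<Longrightarrow> \<not> good_letter p x \<Longrightarrow> block_weight p x < kazhdan_degree p x"
  by (cases x; auto simp: of_bool_def)+

lemma wdeg_mono:
  assumes "\<And>x. x \<in> set w \<Longrightarrow> h x \<le> (g x :: int)"
  shows "wdeg h w \<le> wdeg g w"
  using assms by (induction w) (auto intro: add_mono)

lemma upper_letter_act:
  assumes "x \<in> letters F n" "upper_letter x"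
  obtains "good_letter p x" "block_weight p x = 0" "kazhdan_degree p x = 0"
      "\<And>v. q (\<rho> (unit_of x) v) = smul \<kappa> (q v)"
  | "\<not> good_letter p x" "\<And>v. q (\<rho> (unit_of x) v) = 0"
proof -
  obtain s i j where x: "x = (s, i, j)" by (cases x)
  show ?thesis
    using assms that q_upper[of s i j] unfolding x by (cases "j = Suc i") (auto simp: x)
qed

text \<open>A letter on which the character is defined may be moved to the front and replaced by its
value; where this value is not zero, the letter has \<open>\<delta> = \<beta> = 0\<close>, so that the rest of the word still has
\<open>\<delta> < \<beta>\<close>. A word without such letters has \<open>\<beta> \<le> \<delta>\<close>, because each of its letters does.\<close>

lemma low_words_vanish: "kills_low N"
proof (induction N)
  case (Suc N)
  show ?case
    unfolding kills_low_def
  proof (intro allI impI)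
    fix w v assume w: "length w < Suc N" "set w \<subseteq> letters F n" "\<delta> w < \<beta> w"
    show "q (word_act w v) = 0"
    proof (cases "\<exists>x\<in>set w. upper_letter x")
      case False
      then have "\<beta> w \<le> \<delta> w" using non_upper_degree(1) by (intro wdeg_mono) blast
      then show ?thesis using w(3) by simp
    next
      case True
      then obtain x where x: "x \<in> set w" "upper_letter x" by blast
      obtain a b where wab: "w = a @ x # b" using split_list[OF x(1)] by blast
      have low: "kills_low (length w)" using Suc w(1) unfolding kills_low_def by auto
      have "q (word_act ([] @ a @ x # b) v) = q (word_act ([] @ x # a @ b) v)"
        by (rule move_letter_front) (use low w wab in simp_all)
      then have eq: "q (word_act w v) = q (\<rho> (unit_of x) (word_act (a @ b) v))" by (simp add: wab)
      have xl: "x \<in> letters F n" using x w(2) by blast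
      show ?thesis
      proof (cases rule: upper_letter_act[OF xl x(2)])
        case 1
        have "length (a @ b) < N" "set (a @ b) \<subseteq> letters F n" "\<delta> (a @ b) < \<beta> (a @ b)"
          using w wab 1(2,3) by auto
        then have "q (word_act (a @ b) v) = 0" using Suc unfolding kills_low_def by blast
        then show ?thesis unfolding eq 1(4) by simp
      next
        case 2
        then show ?thesis unfolding eq by simp
      qed
    qed
  qed
qed (simp add: kills_low_def)

text \<open>When two letters of a word with \<open>\<delta> \<le> \<beta>\<close> are exchanged, the commutator terms have \<open>\<delta> < \<beta>\<close> and are killed.\<close>

lemma critical_words_symmetric:
  assumes "mset w = mset w'" "set (c @ w) \<subseteq> letters F n" "\<delta> (c @ w) \<le> \<beta> (c @ w)"
  shows "q (word_act (c @ w) v) = q (word_act (c @ w') v)"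
  using assms
proof (induction w arbitrary: c w')
  case (Cons x w)
  then have xw': "x \<in> set w'" by (metis list.set_intros(1) mset_eq_setD)
  obtain a b where w': "w' = a @ x # b" using split_list[OF xw'] by blast
  have m: "mset w = mset (a @ b)" using Cons.prems(1) unfolding w' by simp
  then have deg: "wdeg h w = wdeg h (a @ b)" for h by (rule wdeg_mset)
  have set: "set w = set (a @ b)" using m by (rule mset_eq_setD)
  have "q (word_act (c @ x # w) v) = q (word_act ((c @ [x]) @ w) v)" by simp
  also have "\<dots> = q (word_act ((c @ [x]) @ (a @ b)) v)"
    by (rule Cons.IH[OF m]) (use Cons.prems in simp_all)
  also have "\<dots> = q (word_act (c @ x # a @ b) v)" by simp
  also have "\<dots> = q (word_act (c @ a @ x # b) v)"
    by (rule move_letter_front[symmetric, OF low_words_vanish]) (use Cons.prems deg set in simp_all)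
  finally show ?case unfolding w' .
qed simp

text \<open>After the letters on which the character is defined have been evaluated, all remaining letters
have \<open>\<beta> \<le> \<delta>\<close>, with equality only for good ones.\<close>

lemma bad_critical_words_vanish:
  assumes "set w \<subseteq> letters F n" "\<delta> w \<le> \<beta> w" "\<exists>x\<in>set w. \<not> good_letter p x"
  shows "q (word_act w v) = 0"
  using assms
proof (induction "length w" arbitrary: w)
  case (Suc N)
  show ?case
  proof (cases "\<exists>x\<in>set w. upper_letter x")
    case False
    obtain z where z: "z \<in> set w" "\<not> good_letter p z" using Suc.prems(3) by blast
    obtain a b where w: "w = a @ z # b" using split_list[OF z(1)] by blast
    have "\<beta> a \<le> \<delta> a" "\<beta> b \<le> \<delta> b" using False non_upper_degree(1) unfolding w by (auto intro!: wdeg_mono)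
    moreover have "block_weight p z < kazhdan_degree p z" using False z non_upper_degree(2) by blast
    ultimately show ?thesis using Suc.prems(2) unfolding w by simp
  next
    case True
    then obtain x where x: "x \<in> set w" "upper_letter x" by blast
    obtain a b where wab: "w = a @ x # b" using split_list[OF x(1)] by blast
    have "q (word_act ([] @ w) v) = q (word_act ([] @ x # a @ b) v)"
      by (rule critical_words_symmetric) (use Suc.prems wab in simp_all)
    then have eq: "q (word_act w v) = q (\<rho> (unit_of x) (word_act (a @ b) v))" by simp
    have xl: "x \<in> letters F n" using x Suc.prems(1) by blast
    show ?thesis
    proof (cases rule: upper_letter_act[OF xl x(2)])
      case 1
      have "q (word_act (a @ b) v) = 0"
        by (rule Suc.hyps(1)) (use Suc.hyps(2) Suc.prems wab 1(1-3) in auto)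
      then show ?thesis unfolding eq 1(4) by simp
    next
      case 2
      then show ?thesis unfolding eq by simp
    qed
  qed
qed simp

text \<open>The key step. Let \<open>t\<close> annihilate the module and have leading term \<open>f\<close>, the given power. The word
\<open>w0\<close> is the \<open>k\<close>-fold concatenation of the path \<open>i, p, ..., n-1\<close>. In the component of \<open>t\<close> of the
weight of \<open>w0\<close>, the shorter words are killed by \<open>q\<close>. The leading words are grouped by their
monomials: within a group \<open>q\<close> does not distinguish the words, and their coefficients add up to the
coefficient of the monomial in \<open>f\<close>. The only monomial of \<open>f\<close> without a bad letter is
that of \<open>w0\<close>, with coefficient 1, and words with a bad letter are killed. So \<open>q\<close> kills
the word \<open>w0\<close>; but it also evaluates this word to a nonzero multiple of the \<open>k\<close>-th power.\<close>

lemma column_letter_nilpotent: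
  assumes s: "s \<in> embs F" and i: "i < p"
    and k: "var_mpow n s (n - p) (n - 1) i ^ k \<in> symbol_ideal"
  shows "q ((\<rho> (unit_of (s, i, p)) ^^ k) v) = 0"
proof -
  define r where "r = n - p - 1"
  have r: "n - p = Suc r" "n - 1 = p + r" "p + r < n" using p by (auto simp: r_def)
  let ?x = "(s, i, p)"
  define \<pi> where "\<pi> = steps s p r @ [?x]"
  define w0 where "w0 = concat (replicate k \<pi>)"
  define f where "f = var_mpow n s (n - p) (n - 1) i ^ k"
  have steps_l: "set (steps s p j) \<subseteq> letters F n \<and> (\<forall>x\<in>set (steps s p j). good_letter p x) \<and>
      \<beta> (steps s p j) = 0 \<and> \<delta> (steps s p j) = 0" if "j \<le> r" for j
    using that by (induction j) (use s r in \<open>auto simp: steps_simps letters_def\<close>)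
  have \<pi>: "set \<pi> \<subseteq> letters F n" "\<forall>x\<in>set \<pi>. good_letter p x" "\<beta> \<pi> = 1" "\<delta> \<pi> = 1"
    using steps_l[of r] s i p by (auto simp: \<pi>_def letters_def)
  have w0: "set w0 \<subseteq> letters F n \<and> (\<forall>x\<in>set w0. good_letter p x) \<and> \<beta> w0 = int k \<and> \<delta> w0 = int k"
    unfolding w0_def by (induction k) (use \<pi> in auto)
  have single_w0: "Poly_Mapping.single (word_mon \<pi>) 1 ^ k = Poly_Mapping.single (word_mon w0) (1::complex)"
    unfolding w0_def by (induction k) (simp_all add: mult_single)
  have f_mod: "f - Poly_Mapping.single (word_mon w0) 1 \<in> bad_ideal p"
    unfolding f_def single_w0[symmetric] r(1,2) \<pi>_def
    by (rule power_diff_in_ideal[OF is_ideal_bad_ideal var_mpow_mod_bad_ideal[OF r(3) i]])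
  have f_bad: "\<exists>x\<in>set w. \<not> good_letter p x"
    if "Poly_Mapping.lookup f (word_mon w) \<noteq> 0" "word_mon w \<noteq> word_mon w0" for w
  proof -
    have "word_mon w \<in> Poly_Mapping.keys (f - Poly_Mapping.single (word_mon w0) 1)"
      using that by (simp add: in_keys_iff lookup_minus lookup_single)
    then show ?thesis using f_mod unfolding bad_ideal_def keys_word_mon[symmetric] by blast
  qed
  have f_w0: "Poly_Mapping.lookup f (word_mon w0) = 1"
  proof (rule ccontr)
    assume "Poly_Mapping.lookup f (word_mon w0) \<noteq> 1"
    then have "word_mon w0 \<in> Poly_Mapping.keys (f - Poly_Mapping.single (word_mon w0) 1)"
      by (simp add: in_keys_iff lookup_minus)
    then obtain x where "x \<in> set w0" "\<not> good_letter p x"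
      using f_mod unfolding bad_ideal_def keys_word_mon[symmetric] by blast
    then show False using w0 by blast
  qed
  obtain t where t: "t \<in> annihilating (length w0)"
    and ft: "\<And>w. set w \<subseteq> letters F n \<Longrightarrow> length w = length w0 \<Longrightarrow>
      Poly_Mapping.lookup f (word_mon w) = Poly_Mapping.lookup (homogeneous_image (length w0) t) (word_mon w)"
    using k unfolding symbol_ideal_def f_def[symmetric] by blast
  define c where "c = Poly_Mapping.lookup t"
  define W where "W = Poly_Mapping.keys t"
  have W: "finite W" "\<And>w. w \<in> W \<Longrightarrow> set w \<subseteq> letters F n" "\<And>w. w \<in> W \<Longrightarrow> length w \<le> length w0"
    and tz: "(\<Sum>w\<in>W. smul (c w) (word_act w v)) = 0" for v
    using t by (auto simp: W_def annihilating_def tensor_algebra_def tens_act_def c_def)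
  \<comment> \<open>A complex weight records two integral ones: \<open>\<beta>\<close> is the imaginary part, and
    the length minus \<open>\<delta>\<close> is the real part.\<close>
  define \<eta> where "\<eta> = (\<lambda>a. Complex (- of_nat (a - p)) (of_bool (a < p)))"
  define wt where "wt = (\<lambda>w :: letter list. sum_list (map (\<lambda>(s, i, j). \<eta> i - \<eta> j) w))"
  have wt: "wt w = Complex (of_int (int (length w) - \<delta> w)) (of_int (\<beta> w))" for w
    unfolding wt_def by (induction w) (auto simp: \<eta>_def complex_eq_iff)
  have wt_eq: "wt w = wt w0 \<longleftrightarrow> int (length w) - \<delta> w = int (length w0) - \<delta> w0 \<and> \<beta> w = \<beta> w0" for w
    unfolding wt by (simp del: of_int_diff)
  define S where "S = {w \<in> W. wt w = wt w0 \<and> length w = length w0}"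
  have S: "set w \<subseteq> letters F n" "\<delta> w = \<beta> w" "length w = length w0" if "w \<in> S" for w
    using that W(2) w0 unfolding S_def wt_eq by auto
  let ?G = "\<lambda>w. q (word_act w v)"
  have "(\<Sum>w | w \<in> W \<and> wt w = wt w0. smul (c w) (word_act w v)) = 0"
    unfolding wt_def using weight_component_annihilates[OF W(1,2) tz] by blast
  then have "0 = (\<Sum>w | w \<in> W \<and> wt w = wt w0. smul (c w) (?G w))"
    using q_simps(3) by (metis (no_types, lifting) q_simps(2,5) sum.cong)
  also have "\<dots> = (\<Sum>w\<in>S. smul (c w) (?G w))"
  proof (rule sum.mono_neutral_right)
    show "\<forall>w\<in>{w \<in> W. wt w = wt w0} - S. smul (c w) (?G w) = 0"
    proof
      fix w assume w: "w \<in> {w \<in> W. wt w = wt w0} - S"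
      then have "length w < length w0" using W(3)[of w] by (auto simp: S_def)
      \<comment> \<open>The length minus \<open>\<delta>\<close> is fixed, so a shorter word has a smaller \<open>\<delta>\<close>.\<close>
      then have "\<delta> w < \<beta> w" using w w0 by (auto simp: wt_eq)
      then have "?G w = 0"
        using low_words_vanish[of "Suc (length w)"] w W(2)[of w] unfolding kills_low_def by auto
      then show "smul (c w) (?G w) = 0" by simp
    qed
  qed (use W(1) in \<open>auto simp: S_def\<close>)
  also have "\<dots> = (\<Sum>e\<in>word_mon ` S. \<Sum>w\<in>{w \<in> S. word_mon w = e}. smul (c w) (?G w))"
    by (rule sum.image_gen) (simp add: S_def W(1))
  also have "\<dots> = (\<Sum>e\<in>word_mon ` S. if e = word_mon w0 then ?G w0 else 0)"
  proof (rule sum.cong[OF refl])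
    fix e assume "e \<in> word_mon ` S"
    then obtain w1 where w1: "w1 \<in> S" "e = word_mon w1" by blast
    have G: "?G w = ?G w1" if "w \<in> S" "word_mon w = e" for w
      using critical_words_symmetric[of w w1 "[]"] S[OF that(1)] that(2) w1(2) by (simp add: word_mon_eq_iff)
    have same: "{w \<in> S. word_mon w = e} = {w. w \<in> Poly_Mapping.keys t \<and> length w = length w0 \<and> word_mon w = e}"
    proof -
      have "wt w = wt w0" if "word_mon w = e" for w
      proof -
        have m: "mset w = mset w1" using that w1(2) by (simp add: word_mon_eq_iff)
        then have "wt w = wt w1" unfolding wt using wdeg_mset[OF m] mset_eq_length[OF m] by simp
        then show ?thesis using w1(1) by (simp add: S_def)
      qed
      then show ?thesis by (auto simp: S_def W_def)
    qed
    have "(\<Sum>w\<in>{w \<in> S. word_mon w = e}. smul (c w) (?G w)) = (\<Sum>w\<in>{w \<in> S. word_mon w = e}. smul (c w) (?G w1))"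
      using G by (intro sum.cong) auto
    also have "\<dots> = smul (Poly_Mapping.lookup f e) (?G w1)"
      unfolding scale_sum_left[symmetric] same unfolding w1(2) ft[OF S(1,3)[OF w1(1)]] lookup_homogeneous_image c_def ..
    also have "\<dots> = (if e = word_mon w0 then ?G w0 else 0)"
    proof (cases "e = word_mon w0")
      case True
      then have "?G w1 = ?G w0"
        using critical_words_symmetric[of w1 w0 "[]"] S[OF w1(1)] w1(2) by (simp add: word_mon_eq_iff)
      then show ?thesis using True f_w0 by simp
    next
      case False
      then have "Poly_Mapping.lookup f e = 0 \<or> ?G w1 = 0"
        using f_bad[of w1] bad_critical_words_vanish[of w1 v] S[OF w1(1)] w1(2) by auto
      then show ?thesis using False by auto
    qed
    finally show "(\<Sum>w\<in>{w \<in> S. word_mon w = e}. smul (c w) (?G w)) = (if e = word_mon w0 then ?G w0 else 0)" .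
  qed
  also have "\<dots> = ?G w0"
  proof -
    have "word_mon w0 \<in> word_mon ` S"
    proof (rule ccontr)
      assume no: "word_mon w0 \<notin> word_mon ` S"
      have wt0: "wt w = wt w0" if "word_mon w = word_mon w0" for w
        unfolding wt using that wdeg_mset[of w w0] mset_eq_length[of w w0] by (simp add: word_mon_eq_iff)
      have none: "{w. w \<in> Poly_Mapping.keys t \<and> length w = length w0 \<and> word_mon w = word_mon w0} = {}"
      proof (rule equals0I)
        fix w assume w: "w \<in> {w. w \<in> Poly_Mapping.keys t \<and> length w = length w0 \<and> word_mon w = word_mon w0}"
        then have "w \<in> S" using wt0[of w] by (simp add: S_def W_def)
        then have "word_mon w \<in> word_mon ` S" by (rule imageI)
        then show False using no w by simp
      qed
      have "Poly_Mapping.lookup f (word_mon w0) = 0"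
        using ft[of w0] w0 unfolding lookup_homogeneous_image none sum.empty by blast
      then show False using f_w0 by simp
    qed
    then show ?thesis using W(1) by (simp add: S_def)
  qed
  finally have G0: "?G w0 = 0" by simp
  let ?U = "concat (replicate k (steps s p r))"
  have ms: "mset w0 = mset (?U @ replicate k ?x)"
    unfolding w0_def \<pi>_def by (induction k) (simp_all add: ac_simps)
  have "?G w0 = q (word_act (?U @ replicate k ?x) v)"
    using critical_words_symmetric[OF ms, of "[]" v] w0 by simp
  also have "\<dots> = smul (\<kappa> ^ length ?U) (q (word_act (replicate k ?x) v))"
  proof -
    have step: "q (\<rho> (unit_of y) u) = smul \<kappa> (q u)" if "y \<in> set ?U" for y u
      using that q_upper[of s _ _ u] s r(3) by (auto simp: steps_def letters_def split: if_splits)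
    have "q (word_act (w @ b) v) = smul (\<kappa> ^ length w) (q (word_act b v))" if "set w \<subseteq> set ?U" for w b
      using that by (induction w) (auto simp: step simp del: set_concat)
    then show ?thesis by blast
  qed
  finally have "q (word_act (replicate k ?x) v) = 0" using G0 \<kappa> by simp
  moreover have "word_act (replicate k ?x) v = (\<rho> (unit_of ?x) ^^ k) v"
    by (induction k) simp_all
  ultimately show ?thesis by simp
qed

end

section \<open>Nilpotence of a whole column\<close>

text \<open>As in the binomial theorem: each term of the expanded power contains \<open>A\<close> at least \<open>a\<close> times
or \<open>B\<close> at least \<open>b\<close> times. The induction tracks the factors that have already been multiplied out.\<close>

lemma sum_of_commuting_nilpotents:
  fixes A B q :: "'v::ab_group_add \<Rightarrow> 'v"
  assumes q: "q 0 = 0" "\<And>u v. q (u + v) = q u + q v"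
    and A: "\<And>u v. A (u + v) = A u + A v" and B: "\<And>u v. B (u + v) = B u + B v"
    and comm: "\<And>v. A (B v) = B (A v)"
    and a: "\<And>v. q ((A ^^ a) v) = 0" and b: "\<And>v. q ((B ^^ b) v) = 0"
  shows "q (((\<lambda>v. A v + B v) ^^ (a + b)) v) = 0"
proof -
  let ?S = "\<lambda>v. A v + B v"
  have S_add: "(?S ^^ N) (u + v) = (?S ^^ N) u + (?S ^^ N) v" for N u v
    by (induction N) (simp_all add: A B algebra_simps)
  have BA: "B ((A ^^ i) v) = (A ^^ i) (B v)" for i v
    by (induction i) (simp_all add: comm[symmetric])
  have BA': "(B ^^ j) ((A ^^ i) v) = (A ^^ i) ((B ^^ j) v)" for i j v
    by (induction j) (simp_all add: BA)
  have "q ((?S ^^ N) ((A ^^ i) ((B ^^ j) v))) = 0" if "a + b \<le> N + i + j" for N i j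
    using that
  proof (induction N arbitrary: i j)
    case 0
    show ?case
    proof (cases "a \<le> i")
      case True
      then have "(A ^^ i) ((B ^^ j) v) = (A ^^ a) ((A ^^ (i - a)) ((B ^^ j) v))"
        by (metis comp_apply funpow_add le_add_diff_inverse)
      then show ?thesis using a by simp
    next
      case False
      then have "b \<le> j" using 0 by simp
      then have "(A ^^ i) ((B ^^ j) v) = (B ^^ b) ((A ^^ i) ((B ^^ (j - b)) v))"
        unfolding BA' by (metis comp_apply funpow_add le_add_diff_inverse)
      then show ?thesis using b by simp
    qed
  next
    case (Suc N)
    have "(?S ^^ Suc N) ((A ^^ i) ((B ^^ j) v))
        = (?S ^^ N) ((A ^^ Suc i) ((B ^^ j) v)) + (?S ^^ N) ((A ^^ i) ((B ^^ Suc j) v))"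
      unfolding funpow_Suc_right comp_apply S_add BA by (simp only: funpow_swap1)
    then show ?case using Suc.IH[of "Suc i" j] Suc.IH[of i "Suc j"] Suc.prems q(2) by simp
  qed
  from this[of "a + b" 0 0] show ?thesis by simp
qed

lemma v_alg_support:
  assumes "X \<in> v_alg F (Suc p)" "X s i j \<noteq> 0"
  shows "s \<in> embs F \<and> i < p \<and> j = p"
proof -
  have X: "X \<in> gl F (Suc p)" "\<forall>s j. X s p j = 0" "\<forall>s i j. j \<noteq> p \<longrightarrow> X s i j = 0"
    using assms(1) by (simp_all add: v_alg_def p_alg_def)
  have "s \<in> embs F \<and> i < Suc p" "i \<noteq> p" "j = p"
    using X assms(2) unfolding gl_iff by blast+
  then show ?thesis by simp
qed

context whittaker_quotient
begin

lemma column_act_nilpotent: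
  assumes nil: "\<And>s i. s \<in> embs F \<Longrightarrow> i < p \<Longrightarrow> \<exists>k. \<forall>v. q ((\<rho> (unit_of (s, i, p)) ^^ k) v) = 0"
  shows "\<exists>k. \<forall>X\<in>v_alg F (Suc p). \<forall>v. q ((\<rho> X ^^ k) v) = 0"
proof -
  \<comment> \<open>Induction on the set of positions where \<open>X\<close> may be nonzero gives a bound that does not depend on \<open>X\<close>.\<close>
  have step: "\<exists>k. \<forall>X. (\<forall>s i j. X s i j \<noteq> 0 \<longrightarrow> (s, i) \<in> T \<and> j = p) \<longrightarrow> (\<forall>v. q ((\<rho> X ^^ k) v) = 0)"
    if "finite T" "T \<subseteq> embs F \<times> {..<p}" for T
    using that
  proof (induction T)
    case empty
    have "q ((\<rho> X ^^ 1) v) = 0" if "\<forall>s i j. X s i j \<noteq> 0 \<longrightarrow> (s, i) \<in> {} \<and> j = p" for X v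
    proof -
      have "X = (\<lambda>s i j. 0)" using that by (auto simp: fun_eq_iff)
      then show ?thesis by (simp add: act_zero q_simps)
    qed
    then show ?case by blast
  next
    case (insert y T)
    obtain s0 i0 where y: "y = (s0, i0)" by (cases y)
    have si: "s0 \<in> embs F" "i0 < p" using insert.prems y by auto
    let ?E = "unit_of (s0, i0, p)"
    have El: "(s0, i0, p) \<in> letters F n" using si p by (simp add: letters_def)
    have E: "?E \<in> gl F n" by (rule unit_of_in_gl[OF El])
    obtain a where a: "\<And>X v. (\<forall>s i j. X s i j \<noteq> 0 \<longrightarrow> (s, i) \<in> T \<and> j = p) \<Longrightarrow> q ((\<rho> X ^^ a) v) = 0"
      using insert by blast
    obtain b where b: "\<And>v. q ((\<rho> ?E ^^ b) v) = 0" using nil[OF si] by blast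
    have b': "q ((\<rho> (gscale c ?E) ^^ b) v) = 0" for c v
    proof -
      have "(\<rho> (gscale c ?E) ^^ m) v = smul (c ^ m) ((\<rho> ?E ^^ m) v)" for m
        by (induction m) (simp_all add: act_scale[OF E] act_linear_simps[OF E] mult.commute)
      then show ?thesis by (simp add: q_simps b)
    qed
    have "q ((\<rho> X ^^ (a + b)) v) = 0"
      if X: "\<forall>s i j. X s i j \<noteq> 0 \<longrightarrow> (s, i) \<in> insert y T \<and> j = p" for X v
    proof -
      define Y where "Y = (\<lambda>s i j. if (s, i) = y then 0 else X s i j)"
      define Z where "Z = gscale (X s0 i0 p) ?E"
      have Ysupp: "\<forall>s i j. Y s i j \<noteq> 0 \<longrightarrow> (s, i) \<in> T \<and> j = p" using X by (auto simp: Y_def)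
      have Y: "Y \<in> gl F n" unfolding gl_iff using Ysupp insert.prems p by fastforce
      have Z: "Z \<in> gl F n" unfolding Z_def by (rule gl_closed(2)[OF E])
      have XYZ: "X = gadd Y Z"
        using X by (auto simp: gadd_def Y_def Z_def gscale_def fun_eq_iff y unit_of.simps)
      have Zsupp: "Z s i j \<noteq> 0 \<Longrightarrow> i < p \<and> j = p" for s i j
        using si by (auto simp: Z_def gscale_def unit_of.simps split: if_splits)
      have Yp: "Y s p j = 0" "Z s p j = 0" for s j
        using Ysupp Zsupp[of s p j] insert.prems by auto
      have Yj: "j \<noteq> p \<Longrightarrow> Y s i j = 0" "j \<noteq> p \<Longrightarrow> Z s i j = 0" for s i j
        using Ysupp Zsupp by blast+
      have "mmult n (Y s) (Z s) i j = 0" "mmult n (Z s) (Y s) i j = 0" for s i j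
        unfolding mmult_def by (auto intro!: sum.neutral) (metis Yj Yp)+
      then have "gbracket n Y Z = (\<lambda>s i j. 0)" by (simp add: gbracket_def)
      then have comm: "\<rho> Y (\<rho> Z u) = \<rho> Z (\<rho> Y u)" for u
        using act_bracket[OF Y Z, of u] act_zero[of u] by simp
      have "\<rho> X = (\<lambda>v. \<rho> Y v + \<rho> Z v)" unfolding XYZ using act_add[OF Y Z] by blast
      then show ?thesis
        using sum_of_commuting_nilpotents[of q "\<rho> Y" "\<rho> Z" a b v] q_simps(1,3)
          act_linear_simps(1)[OF Y] act_linear_simps(1)[OF Z] comm a[OF Ysupp] b'[folded Z_def] Z_def
        by (simp add: b')
    qed
    then show ?case by blast
  qed
  have fin: "finite (embs F \<times> {..<p})" by (cases F) auto
  from step[OF fin order_refl] obtain k where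
    k: "\<And>X v. (\<forall>s i j. X s i j \<noteq> 0 \<longrightarrow> (s, i) \<in> embs F \<times> {..<p} \<and> j = p) \<Longrightarrow> q ((\<rho> X ^^ k) v) = 0"
    by blast
  have "q ((\<rho> X ^^ k) v) = 0" if "X \<in> v_alg F (Suc p)" for X v
    by (rule k) (use v_alg_support[OF that] in auto)
  then show ?thesis by blast
qed

end

section \<open>Iterated derivatives as one quotient\<close>

context vector_space
begin

lemma complement_exists:
  assumes "subspace C" "subspace W" "W \<subseteq> C"
  shows "\<exists>D. subspace D \<and> D \<subseteq> C \<and> D \<inter> W = {0} \<and> (\<forall>v\<in>C. \<exists>x\<in>D. v - x \<in> W)"
proof -
  obtain B where B: "B \<subseteq> W" "independent B" "W \<subseteq> span B"
    using maximal_independent_subset by blast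
  obtain B' where B': "B \<subseteq> B'" "B' \<subseteq> C" "independent B'" "C \<subseteq> span B'"
    using maximal_independent_subset_extend[of B C] B assms(3) by blast
  have W: "W = span B" using B span_minimal[OF _ assms(2)] by blast
  let ?D = "span (B' - B)"
  have "?D \<inter> W = {0}"
  proof -
    have "x = 0" if x: "x \<in> span (B' - B)" "x \<in> span B" for x
    proof -
      have ind: "independent ((B' - B) \<union> B)" using B'(1,3) by (simp add: Un_absorb2)
      have 1: "representation ((B' - B) \<union> B) x = representation (B' - B) x"
        by (rule representation_extend[OF ind x(1)]) blast
      have 2: "representation ((B' - B) \<union> B) x = representation B x"
        by (rule representation_extend[OF ind x(2)]) blast
      have "representation B x b = 0" for b
        using 1 2 representation_ne_zero[of B x b] representation_ne_zero[of "B' - B" x b] by auto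
      then have "{b. representation B x b \<noteq> 0} = {}" by simp
      then show ?thesis using sum_nonzero_representation_eq[OF B(2) x(2)] by simp
    qed
    then show ?thesis using span_zero unfolding W by blast
  qed
  moreover have "\<exists>x\<in>?D. v - x \<in> W" if "v \<in> C" for v
  proof -
    have "B' = (B' - B) \<union> B" using B'(1) by blast
    then have "v \<in> span ((B' - B) \<union> B)" using that B'(4) by auto
    then obtain x y where "v = x + y" "x \<in> ?D" "y \<in> span B" unfolding span_Un by blast
    then show ?thesis unfolding W by (intro bexI[of _ x]) simp_all
  qed
  moreover have "?D \<subseteq> C" using B'(2) assms(1) by (intro span_minimal) auto
  ultimately show ?thesis using subspace_span by blast
qed

end

lemma gl_mono: "m \<le> n \<Longrightarrow> gl F m \<subseteq> gl F n"
  unfolding gl_iff subset_iff by (meson order_less_le_trans)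

lemma p_alg_mono: "p_alg F (m - 1) \<subseteq> p_alg F m"
proof
  fix X assume X: "X \<in> p_alg F (m - 1)"
  then have gl: "X \<in> gl F (m - 1)" by (simp add: p_alg_def)
  have "X s (m - 1) j = 0" for s j using gl unfolding gl_iff by (metis less_irrefl)
  then show "X \<in> p_alg F m" using gl gl_mono[of "m - 1" m F] by (auto simp: p_alg_def)
qed

lemma v_alg_diagonal: "X \<in> v_alg F m \<Longrightarrow> X s i i = 0"
  by (cases "i = m - 1") (auto simp: v_alg_def p_alg_def)

text \<open>The mirabolic algebra of size \<open>m - 1\<close> normalizes \<open>v_alg F m\<close> and fixes its character. The latter
depends only on row \<open>m - 2\<close>, which vanishes for elements of \<open>p_alg F (m - 1)\<close>.\<close>

lemma bracket_v_alg:
  assumes m: "m \<le> n" "1 \<le> m" and X: "X \<in> p_alg F (m - 1)" and \<alpha>: "\<alpha> \<in> v_alg F m"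
  shows "gbracket n X \<alpha> \<in> v_alg F m" "psi F m (gbracket n X \<alpha>) = 0"
proof -
  have Xgl: "X s i j \<noteq> 0 \<Longrightarrow> s \<in> embs F \<and> i < m - 1 \<and> j < m - 1" for s i j
    using X unfolding p_alg_def gl_iff by blast
  have Xrow: "X s (m - 2) j = 0" for s j
    using X by (simp add: p_alg_def numeral_2_eq_2)
  have al: "\<alpha> s i j \<noteq> 0 \<Longrightarrow> s \<in> embs F \<and> i < m - 1 \<and> j = m - 1" for s i j
    using v_alg_support[of \<alpha> F "m - 1" s i j] \<alpha> m(2) by simp
  have zero: "mmult n (\<alpha> s) (X s) i j = 0" for s i j
    unfolding mmult_def
  proof (rule sum.neutral, rule ballI)
    fix k
    show "\<alpha> s i k * X s k j = 0" using al[of s i k] Xgl[of s k j] by fastforce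
  qed
  have br: "gbracket n X \<alpha> = (\<lambda>s. mmult n (X s) (\<alpha> s))"
    by (simp add: gbracket_def zero)
  have supp: "s \<in> embs F \<and> i < m - 1 \<and> j = m - 1" if nz: "mmult n (X s) (\<alpha> s) i j \<noteq> 0" for s i j
  proof -
    obtain k where k: "X s i k * \<alpha> s k j \<noteq> 0"
      by (rule sum.not_neutral_contains_not_neutral[OF nz[unfolded mmult_def]])
    then have "X s i k \<noteq> 0" "\<alpha> s k j \<noteq> 0" by auto
    then show ?thesis using Xgl[of s i k] al[of s k j] by blast
  qed
  have "gbracket n X \<alpha> \<in> gl F m"
    unfolding br gl_iff
  proof (intro allI impI)
    fix s i j assume "mmult n (X s) (\<alpha> s) i j \<noteq> 0"
    from supp[OF this] show "s \<in> embs F \<and> i < m \<and> j < m" using m(2) by auto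
  qed
  then show "gbracket n X \<alpha> \<in> v_alg F m"
    using supp unfolding v_alg_def p_alg_def br by blast
  have "mmult n (X s) (\<alpha> s) (m - 2) (m - 1) = 0" for s
    by (simp add: mmult_def Xrow)
  then show "psi F m (gbracket n X \<alpha>) = 0"
    by (simp add: psi_def re_ext_def br)
qed

context gl_module
begin

text \<open>\<open>coset_rep\<close> is a linear projection with kernel \<open>W\<close>, so that the chosen complement behaves as the
quotient of \<open>C\<close> by \<open>W\<close>.\<close>

lemma coset_rep_props:
  assumes C: "subspace C" and W: "subspace W" "W \<subseteq> C"
  defines "\<pi> \<equiv> coset_rep smul C W"
  shows "\<And>v. v \<in> C \<Longrightarrow> \<pi> v \<in> complement smul C W \<and> v - \<pi> v \<in> W"
    and "\<And>v w. v \<in> C \<Longrightarrow> w \<in> C \<Longrightarrow> v - w \<in> W \<Longrightarrow> \<pi> v = \<pi> w"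
    and "\<And>v w. v \<in> C \<Longrightarrow> w \<in> C \<Longrightarrow> \<pi> (v + w) = \<pi> v + \<pi> w"
    and "\<And>v c. v \<in> C \<Longrightarrow> \<pi> (smul c v) = smul c (\<pi> v)"
    and "complement smul C W = \<pi> ` C"
proof -
  let ?D = "complement smul C W"
  have "subspace ?D \<and> ?D \<subseteq> C \<and> ?D \<inter> W = {0} \<and> (\<forall>v\<in>C. \<exists>x\<in>?D. v - x \<in> W)"
    unfolding complement_def by (rule someI_ex) (rule complement_exists[OF C W])
  then have D: "subspace ?D" "?D \<subseteq> C" "?D \<inter> W = {0}" "\<And>v. v \<in> C \<Longrightarrow> \<exists>x\<in>?D. v - x \<in> W" by blast+
  have uniq: "x = y" if "x \<in> ?D" "v - x \<in> W" "y \<in> ?D" "v - y \<in> W" for x y v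
  proof -
    have "x - y \<in> ?D" using subspace_diff[OF D(1)] that by blast
    moreover have "(v - y) - (v - x) \<in> W" using subspace_diff[OF W(1)] that by blast
    then have "x - y \<in> W" by simp
    ultimately have "x - y = 0" using D(3) by blast
    then show ?thesis by simp
  qed
  have rep: "\<pi> v = x" if "x \<in> ?D" "v - x \<in> W" for v x
    unfolding \<pi>_def coset_rep_def using that uniq by (intro the_equality) blast+
  show spec: "\<pi> v \<in> ?D \<and> v - \<pi> v \<in> W" if v: "v \<in> C" for v
  proof -
    obtain x where x: "x \<in> ?D" "v - x \<in> W" using D(4)[OF v] by blast
    show ?thesis using rep[OF x] x by simp
  qed
  show "\<pi> v = \<pi> w" if "v \<in> C" "w \<in> C" "v - w \<in> W" for v w
  proof (rule rep)
    show "\<pi> w \<in> ?D" using spec[OF that(2)] by blast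
    have "(v - w) + (w - \<pi> w) \<in> W" using subspace_add[OF W(1)] that(3) spec[OF that(2)] by blast
    then show "v - \<pi> w \<in> W" by simp
  qed
  show "\<pi> (v + w) = \<pi> v + \<pi> w" if "v \<in> C" "w \<in> C" for v w
  proof (rule rep)
    show "\<pi> v + \<pi> w \<in> ?D" using spec that subspace_add[OF D(1)] by blast
    have "(v - \<pi> v) + (w - \<pi> w) \<in> W" using spec that subspace_add[OF W(1)] by blast
    then show "v + w - (\<pi> v + \<pi> w) \<in> W" by (simp add: algebra_simps)
  qed
  show "\<pi> (smul c v) = smul c (\<pi> v)" if "v \<in> C" for v c
  proof (rule rep)
    show "smul c (\<pi> v) \<in> ?D" using spec that subspace_scale[OF D(1)] by blast
    have "smul c (v - \<pi> v) \<in> W" using spec that subspace_scale[OF W(1)] by blast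
    then show "smul c v - smul c (\<pi> v) \<in> W" by (simp add: scale_right_diff_distrib)
  qed
  show "?D = \<pi> ` C"
  proof
    show "\<pi> ` C \<subseteq> ?D" using spec by blast
    show "?D \<subseteq> \<pi> ` C"
    proof
      fix x assume x: "x \<in> ?D"
      have "x - x \<in> W" using subspace_0[OF W(1)] by simp
      then have "\<pi> x = x" by (rule rep[OF x])
      then show "x \<in> \<pi> ` C" using x D(2) by force
    qed
  qed
qed

text \<open>The data that identify \<open>M\<close>, the \<open>k\<close>-fold application of \<open>Phi\<close>, with a quotient of the original module:
the projection \<open>q\<close> and the character \<open>ch\<close> accumulated from the twists. It matters
that \<open>ch\<close>, a multiple of partial traces, vanishes on matrices with zero diagonal, and thus on every \<open>v_alg F m\<close>.\<close>

definition derivative_quotient :: "nat \<Rightarrow> (glie \<Rightarrow> complex) \<Rightarrow> ('v \<Rightarrow> 'v) \<Rightarrow> 'v lie_mod \<Rightarrow> bool" where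
  "derivative_quotient k ch q M \<longleftrightarrow> Vector_Spaces.linear smul smul q \<and> carr M = range q \<and>
     (\<forall>X\<in>p_alg F (n - k). \<forall>v. act M X (q v) = q (\<rho> X v) + smul (ch X) (q v)) \<and>
     (\<forall>X. (\<forall>s i. X s i i = 0) \<longrightarrow> ch X = 0) \<and>
     (\<forall>j<k. \<forall>\<alpha>\<in>v_alg F (n - j). \<forall>v. q (\<rho> \<alpha> v) = smul (psi F (n - j) \<alpha>) (q v))"

lemma Phi_derivative_quotient:
  assumes k: "k < n" and dq: "derivative_quotient k ch q M"
  shows "\<exists>ch' q'. derivative_quotient (Suc k) ch' q' (Phi F (n - k) smul M)"
proof -
  let ?m = "n - k"
  have m: "?m \<le> n" "1 \<le> ?m" using k by auto
  have q: "Vector_Spaces.linear smul smul q" and carr: "carr M = range q"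
    and actM: "\<And>X v. X \<in> p_alg F ?m \<Longrightarrow> act M X (q v) = q (\<rho> X v) + smul (ch X) (q v)"
    and ch: "\<And>X. \<forall>s i. X s i i = 0 \<Longrightarrow> ch X = 0"
    and old: "\<And>j \<alpha> v. j < k \<Longrightarrow> \<alpha> \<in> v_alg F (n - j) \<Longrightarrow> q (\<rho> \<alpha> v) = smul (psi F (n - j) \<alpha>) (q v)"
    using dq unfolding derivative_quotient_def by blast+
  interpret q: Vector_Spaces.linear smul smul q by (rule q)
  define C where "C = range q"
  define W where "W = psi_span F ?m smul M"
  let ?rel = "\<lambda>\<alpha> v. \<rho> \<alpha> v - smul (psi F ?m \<alpha>) v"
  have vp: "v_alg F ?m \<subseteq> p_alg F ?m" by (auto simp: v_alg_def)
  have gl: "p_alg F ?m \<subseteq> gl F n" using gl_mono[OF m(1), of F] by (auto simp: p_alg_def)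
  have W_eq: "W = span {q (?rel \<alpha> v) | \<alpha> v. \<alpha> \<in> v_alg F ?m}"
  proof -
    have eq: "act M \<alpha> (q v) - smul (psi F ?m \<alpha>) (q v) = q (?rel \<alpha> v)" if "\<alpha> \<in> v_alg F ?m" for \<alpha> v
      using actM[of \<alpha> v] ch[of \<alpha>] v_alg_diagonal[OF that] vp that by (auto simp: q.diff q.scale)
    have "{act M \<alpha> v - smul (psi F ?m \<alpha>) v | \<alpha> v. \<alpha> \<in> v_alg F ?m \<and> v \<in> carr M}
        = {q (?rel \<alpha> v) | \<alpha> v. \<alpha> \<in> v_alg F ?m}" (is "?L = ?R")
    proof (intro equalityI subsetI)
      fix x assume "x \<in> ?L"
      then obtain \<alpha> u where "x = act M \<alpha> (q u) - smul (psi F ?m \<alpha>) (q u)" "\<alpha> \<in> v_alg F ?m"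
        unfolding carr by blast
      then show "x \<in> ?R" using eq by blast
    next
      fix x assume "x \<in> ?R"
      then obtain \<alpha> u where "x = q (?rel \<alpha> u)" "\<alpha> \<in> v_alg F ?m" by blast
      then have "x = act M \<alpha> (q u) - smul (psi F ?m \<alpha>) (q u)" "\<alpha> \<in> v_alg F ?m" "q u \<in> carr M"
        using eq carr by simp_all
      then show "x \<in> ?L" by blast
    qed
    then show ?thesis unfolding W_def psi_span_def by simp
  qed
  have C: "subspace C" unfolding C_def
    by (rule q.subspace_image) (rule subspace_UNIV)
  have W: "subspace W" unfolding W_eq by (rule subspace_span)
  have WC: "W \<subseteq> C" unfolding W_eq by (rule span_minimal[OF _ C]) (auto simp: C_def)
  define \<pi> where "\<pi> = coset_rep smul C W"
  note pi = coset_rep_props[OF C W WC, folded \<pi>_def]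
  have qC: "q v \<in> C" for v by (simp add: C_def)
  define ch' where "ch' = (\<lambda>X. ch X + - (1 / 2) * abs_det_diff F (?m - 1) X)"
  \<comment> \<open>The relations are stable under \<open>p_alg F (n - k - 1)\<close>, so that this algebra acts on the quotient.\<close>
  have rel_stable: "q (\<rho> X u) \<in> W" if X: "X \<in> p_alg F (?m - 1)" and u: "q u \<in> W" for X u
  proof -
    have Xp: "X \<in> p_alg F ?m" using X p_alg_mono by blast
    have Xgl: "X \<in> gl F n" using Xp gl by blast
    let ?T = "{w \<in> C. act M X w \<in> W}"
    have actq: "act M X (q v) = q (\<rho> X v) + smul (ch X) (q v)" for v by (rule actM[OF Xp])
    have T: "subspace ?T"
    proof (rule subspaceI)
      show "0 \<in> ?T"
        using actq[of 0] subspace_0[OF W] subspace_0[OF C] by (simp add: act_linear_simps[OF Xgl] q.zero)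
    next
      fix x y assume "x \<in> ?T" "y \<in> ?T"
      then obtain a b where ab: "x = q a" "y = q b" "act M X (q a) \<in> W" "act M X (q b) \<in> W"
        unfolding C_def by blast
      have "act M X (x + y) = act M X (q a) + act M X (q b)"
        using actq[of "a + b"] actq[of a] actq[of b] unfolding ab(1,2)
        by (simp add: q.add act_linear_simps[OF Xgl] scale_right_distrib algebra_simps)
      then show "x + y \<in> ?T"
        using subspace_add[OF W ab(3,4)] qC[of "a + b"] unfolding ab(1,2) by (simp add: q.add)
    next
      fix c x assume "x \<in> ?T"
      then obtain a where a: "x = q a" "act M X (q a) \<in> W" unfolding C_def by blast
      have "act M X (smul c x) = smul c (act M X (q a))"
        using actq[of "smul c a"] actq[of a] unfolding a(1)
        by (simp add: q.scale act_linear_simps[OF Xgl] scale_right_distrib mult.commute)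
      then show "smul c x \<in> ?T"
        using subspace_scale[OF W a(2)] qC[of "smul c a"] unfolding a(1) by (simp add: q.scale)
    qed
    have "q (?rel \<alpha> v) \<in> ?T" if \<alpha>: "\<alpha> \<in> v_alg F ?m" for \<alpha> v
    proof -
      have agl: "\<alpha> \<in> gl F n" using \<alpha> vp gl by blast
      note br = bracket_v_alg[OF m X \<alpha>]
      have "\<rho> X (?rel \<alpha> v) = ?rel \<alpha> (\<rho> X v) + ?rel (gbracket n X \<alpha>) v"
        unfolding br(2) act_bracket[OF Xgl agl] by (simp add: act_linear_simps[OF Xgl])
      moreover have "q (?rel \<alpha> (\<rho> X v)) \<in> W" "q (?rel (gbracket n X \<alpha>) v) \<in> W" "q (?rel \<alpha> v) \<in> W"
        unfolding W_eq using \<alpha> br(1) by (blast intro: span_base)+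
      ultimately have "q (\<rho> X (?rel \<alpha> v)) + smul (ch X) (q (?rel \<alpha> v)) \<in> W"
        using subspace_add[OF W] subspace_scale[OF W] by (simp only: q.add)
      then show ?thesis using qC actq by simp
    qed
    then have "{q (?rel \<alpha> v) | \<alpha> v. \<alpha> \<in> v_alg F ?m} \<subseteq> ?T" by blast
    from span_minimal[OF this T] have "W \<subseteq> ?T" by (simp only: W_eq[symmetric])
    then have "act M X (q u) \<in> W" using u by blast
    then have "act M X (q u) - smul (ch X) (q u) \<in> W"
      using subspace_diff[OF W] subspace_scale[OF W u] by blast
    then show ?thesis by (simp add: actq)
  qed
  have Phi: "Phi F ?m smul M = \<lparr>carr = complement smul C W,
      act = (\<lambda>X v. \<pi> (act M X v) + smul (- (1 / 2) * abs_det_diff F (?m - 1) X) v)\<rparr>"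
    unfolding Phi_def twist_def quotient_mod_def W_def[symmetric] by (simp add: \<pi>_def C_def carr)
  have "derivative_quotient (Suc k) ch' (\<pi> \<circ> q) (Phi F ?m smul M)"
    unfolding derivative_quotient_def
  proof (intro conjI allI ballI impI)
    show "Vector_Spaces.linear smul smul (\<pi> \<circ> q)"
      by unfold_locales (simp_all add: q.add q.scale pi(3,4) qC)
    show "carr (Phi F ?m smul M) = range (\<pi> \<circ> q)"
      unfolding Phi lie_mod.simps pi(5) unfolding C_def by (rule image_comp)
  next
    fix X v assume "X \<in> p_alg F (n - Suc k)"
    then have X: "X \<in> p_alg F (?m - 1)" by simp
    then have Xp: "X \<in> p_alg F ?m" using p_alg_mono by blast
    have Xgl: "X \<in> gl F n" using Xp gl by blast
    have "q v - \<pi> (q v) \<in> C" using pi(1)[OF qC, of v] WC by blast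
    from subspace_diff[OF C qC this, of v] have "\<pi> (q v) \<in> C" by simp
    then obtain u where u: "\<pi> (q v) = q u" unfolding C_def by blast
    have "q (v - u) \<in> W" using pi(1)[OF qC, of v] unfolding u q.diff by blast
    then have "q (\<rho> X (v - u)) \<in> W" by (rule rel_stable[OF X])
    then have "\<pi> (q (\<rho> X v)) = \<pi> (q (\<rho> X u))"
      by (intro pi(2)[OF qC qC]) (simp add: q.diff act_linear_simps[OF Xgl])
    moreover have "\<pi> (q u) = \<pi> (q v)"
    proof (rule pi(2)[OF qC qC])
      show "q u - q v \<in> W" using pi(1)[OF qC, of v] subspace_neg[OF W, of "q v - q u"] unfolding u by simp
    qed
    ultimately show "act (Phi F ?m smul M) X ((\<pi> \<circ> q) v)
        = (\<pi> \<circ> q) (\<rho> X v) + smul (ch' X) ((\<pi> \<circ> q) v)"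
      by (simp add: Phi u actM[OF Xp] pi(3,4) qC subspace_scale[OF C qC] ch'_def scale_left_distrib scale_left_diff_distrib)
  next
    fix X :: glie assume "\<forall>s i. X s i i = 0"
    then show "ch' X = 0" using ch[of X] by (simp add: ch'_def abs_det_diff_def re_ext_def)
  next
    fix j \<alpha> v assume j: "j < Suc k" and \<alpha>: "\<alpha> \<in> v_alg F (n - j)"
    show "(\<pi> \<circ> q) (\<rho> \<alpha> v) = smul (psi F (n - j) \<alpha>) ((\<pi> \<circ> q) v)"
    proof (cases "j = k")
      case True
      have "q (\<rho> \<alpha> v) - q (smul (psi F ?m \<alpha>) v) \<in> W"
        unfolding q.diff[symmetric] W_eq using \<alpha> True by (blast intro: span_base)
      then have "\<pi> (q (\<rho> \<alpha> v)) = \<pi> (q (smul (psi F ?m \<alpha>) v))" by (rule pi(2)[OF qC qC])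
      then show ?thesis using True by (simp add: q.scale pi(4) qC)
    next
      case False
      then show ?thesis using old[of j \<alpha> v] j \<alpha> by (simp add: pi(4) qC)
    qed
  qed
  then show ?thesis by blast
qed

end

context gl_module
begin

lemma Phi_iter_derivative_quotient:
  assumes "k \<le> n"
  shows "\<exists>ch q. derivative_quotient k ch q (Phi_iter F n smul k \<lparr>carr = UNIV, act = \<rho>\<rparr>)"
  using assms
proof (induction k)
  case 0
  have "derivative_quotient 0 (\<lambda>X. 0) (\<lambda>v. v) \<lparr>carr = UNIV, act = \<rho>\<rparr>"
    by (simp add: derivative_quotient_def linear_ident)
  then show ?case unfolding Phi_iter.simps by blast
next
  case (Suc k)
  then obtain ch q where "derivative_quotient k ch q (Phi_iter F n smul k \<lparr>carr = UNIV, act = \<rho>\<rparr>)" by auto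
  from Phi_derivative_quotient[OF _ this] Suc.prems show ?case by simp
qed

text \<open>The letters in column \<open>j\<close> are imposed by the derivative from size \<open>j + 1\<close> to size \<open>j\<close>. The columns
\<open>n - d + 1, ..., n - 1\<close> correspond to the \<open>d - 1\<close> derivatives.\<close>

lemma whittaker_quotient_of_derivative:
  assumes d: "1 \<le> d" "d \<le> n" and dq: "derivative_quotient (d - 1) ch q M"
  shows "whittaker_quotient F n smul \<rho> (n - d) (\<i> * of_real pi / of_nat (card (embs F))) q"
proof (intro whittaker_quotient.intro whittaker_quotient_axioms.intro gl_module_axioms)
  show "Vector_Spaces.linear smul smul q" using dq by (simp add: derivative_quotient_def)
  show "\<i> * of_real pi / of_nat (card (embs F)) \<noteq> 0" by (cases F) auto
  show "n - d < n" using d by simp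
next
  fix s i j v
  assume l: "(s, i, j) \<in> letters F n" and ij: "i < j" "n - d < j"
  have jn: "j < n" "i < n" "s \<in> embs F" using l by (auto simp: letters_def)
  define r where "r = n - 1 - j"
  have r: "r < d - 1" "n - r = Suc j" using jn ij d by (auto simp: r_def)
  have E: "unit_of (s, i, j) \<in> v_alg F (n - r)"
    unfolding r(2) v_alg_def p_alg_def mem_Collect_eq gl_iff using jn ij by (auto simp: unit_of.simps)
  have fin: "finite (embs F)" by (cases F) auto
  have "psi F (n - r) (unit_of (s, i, j)) = (if j = Suc i then \<i> * of_real pi / of_nat (card (embs F)) else 0)"
  proof -
    have "(\<Sum>r\<in>embs F. unit_of (s, i, j) r (j - 1) j) = (\<Sum>r\<in>embs F. if r = s then (if j = Suc i then 1 else 0) else 0)"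
      by (rule sum.cong) (use ij in \<open>auto simp: unit_of.simps\<close>)
    also have "\<dots> = (if j = Suc i then 1 else 0)" using jn fin by simp
    finally show ?thesis unfolding r(2) by (simp add: psi_def re_ext_def numeral_2_eq_2)
  qed
  moreover have "q (\<rho> (unit_of (s, i, j)) v) = smul (psi F (n - r) (unit_of (s, i, j))) (q v)"
    using dq r(1) E unfolding derivative_quotient_def by blast
  ultimately show "q (\<rho> (unit_of (s, i, j)) v)
      = smul (if j = Suc i then \<i> * of_real pi / of_nat (card (embs F)) else 0) (q v)" by simp
qed

lemma derivative_column_nilpotent:
  assumes d: "1 \<le> d" "d \<le> n" and depth: "depth F n smul \<rho> \<le> enat d"
  shows "\<exists>k. \<forall>X\<in>v_alg F (n - d + 1). \<forall>v\<in>carr (E_HC F n smul d \<rho>). (act (E_HC F n smul d \<rho>) X ^^ k) v = 0"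
proof -
  define M where "M = E_HC F n smul d \<rho>"
  obtain ch q where dq: "derivative_quotient (d - 1) ch q M"
    using Phi_iter_derivative_quotient[of "d - 1"] d unfolding M_def E_HC_def E_deriv_def
    by (meson diff_le_self order_trans)
  interpret whittaker_quotient F n smul \<rho> "n - d" "\<i> * of_real pi / of_nat (card (embs F))" q
    by (rule whittaker_quotient_of_derivative[OF d dq])
  have "\<exists>k. \<forall>v. q ((\<rho> (unit_of (s, i, n - d)) ^^ k) v) = 0" if s: "s \<in> embs F" and i: "i < n - d" for s i
  proof -
    have "n - (n - d) = d" using d by simp
    then obtain k where "var_mpow n s (n - (n - d)) (n - 1) i ^ k \<in> symbol_ideal"
      using var_mpow_power_in_symbol_ideal[OF depth s] by metis
    then show ?thesis using column_letter_nilpotent[OF s i] by blast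
  qed
  from column_act_nilpotent[OF this] obtain k where
    k: "\<And>X v. X \<in> v_alg F (Suc (n - d)) \<Longrightarrow> q ((\<rho> X ^^ k) v) = 0" by blast
  have "(act M X ^^ k) v = 0" if X: "X \<in> v_alg F (n - d + 1)" and v: "v \<in> carr M" for X v
  proof -
    have n: "n - (d - 1) = n - d + 1" using d by simp
    obtain u where u: "v = q u" using v dq unfolding derivative_quotient_def by blast
    have "X \<in> p_alg F (n - (d - 1))" using X unfolding n v_alg_def by blast
    moreover have "ch X = 0" using dq v_alg_diagonal[OF X] unfolding derivative_quotient_def by blast
    ultimately have "act M X (q w) = q (\<rho> X w)" for w
      using dq unfolding derivative_quotient_def by simp
    then have "(act M X ^^ m) (q u) = q ((\<rho> X ^^ m) u)" for m by (induction m) simp_all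
    then show ?thesis using k X unfolding u by simp
  qed
  then show ?thesis unfolding M_def by blast
qed

end

theorem corollary3p0p6:
  fixes F :: base_field and n d :: nat and K :: "cmat set"
    and smul :: "complex \<Rightarrow> 'v::ab_group_add \<Rightarrow> 'v"
    and \<rho> :: "glie \<Rightarrow> 'v \<Rightarrow> 'v" and \<kappa> :: "cmat \<Rightarrow> 'v \<Rightarrow> 'v"
  assumes "1 \<le> d" and "d \<le> n"
    and "maximal_compact F n K"
    and "harish_chandra_module F n K smul \<rho> \<kappa>"
    and "depth F n smul \<rho> \<le> enat d"
  shows "\<exists>k::nat. \<forall>X\<in>v_alg F (n - d + 1). \<forall>v\<in>carr (E_HC F n smul d \<rho>).
           (act (E_HC F n smul d \<rho>) X ^^ k) v = 0"
proof -
  interpret harish_chandra_module F n K smul \<rho> \<kappa> by (rule assms(4))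
  show ?thesis using assms(1,2,5) by (rule derivative_column_nilpotent)
qed

end
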